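(* Let $k\ge 5$ be an odd integer and let $\Gamma$ be a connected amply regular graph with diameter $d=4$ and parameters $(v,k,0,\mu)$, where $\mu=\frac{k-1}{2}$. Then the following are equivalent: (1) $\Gamma$ is a bipartite $Q$-regular graph with distribution diagram $\mathcal Q_k$ (defined in the context). (2) $\Gamma$ is the point--block incidence graph of a $GDDDP\left(2,k+1;\,k;\,0,\frac{k-1}{2}\right)$. (3) $\Gamma$ is a relation graph with respect to a relation $R$ of a symmetric association scheme $(X,\mathcal R)$ with $5$ classes such that the distribution diagram of $(X,\mathcal R)$ with respect to $R$ is $\mathcal Q_k$. In particular, $\Gamma$ is a bipartite $2$-walk-regular graph of order $4k+4$, diameter $4$, with exactly $6$ distinct eigenvalues.
   Context: All graphs are finite, simple and undirected. An amply regular graph with parameters $(v,k,\lambda,\mu)$ is a $k$-regular graph on $v$ vertices such that every pair of adjacent vertices has exactly $\lambda$ common neighbors and every pair of vertices at distance two has exactly $\mu$ common neighbors. A partition $\{B_1,\dots,B_n\}$ of $V(\Gamma)$ is equitable with quotient matrix $Q=(q_{ij})$ if every vertex of $B_i$ has exactly $q_{ij}$ neighbors in $B_j$, for all $i,j$. The distribution diagram of the partition records the sizes $|B_i|$ and the numbers $q_{ij}$ (it is used interchangeably with the quotient matrix). $\Gamma$ is $Q$-regular if for each vertex $x$ there is an equitable partition of $V(\Gamma)$ with quotient matrix $Q$ such that $\{x\}$ is a part. The distribution diagram $\mathcal Q_k$ has six cells $P_0,P_1,P_2,P_3,P_4,P_5$ of sizes $1,\ k,\ 2k,\ k,\ 1,\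 2$ respectively, with $P_0=\{x\}$, and with the following quotient numbers (all unlisted ones are $0$): $q_{01}=k$; $q_{10}=1$, $q_{12}=k-1$; $q_{21}=\frac{k-1}{2}$, $q_{23}=\frac{k-1}{2}$, $q_{25}=1$; $q_{32}=k-1$, $q_{34}=1$; $q_{43}=k$; $q_{52}=k$. A symmetric association scheme with $n$ classes is a pair $(X,\mathcal R)$, with $X$ a finite set and $\mathcal R=\{R_0,\dots,R_n\}$ a collection of non-empty subsets of $X\times X$ whose adjacency matrices $F_0,\dots,F_n$ are symmetric, with $F_0=I$, $\sum_i F_i=J$ (all-ones matrix), and each $F_iF_j$ a linear combination of $F_0,\dots,F_n$. The relation graph of $R_i$ ($i\ge1$) is the graph $(X,R_i)$. The distribution diagram of $(X,\mathcal R)$ with respect to $R_i$ is the distribution diagram of the graph $(X,R_i)$ with respect to the equitable partition $\{B_0,\dots,B_n\}$, $B_j=\{y\in X:(x,y)\in R_j\}$, for a vertex $x$ (it does not depend on $x$); cells are matched with $\mathcal Q_k$ up to ordering of the relations, with $B_0=\{x\}$ corresponding to $P_0$. A connected graph is $2$-walk-regular if for every $\ell\ge0$ and every pair of vertices $x,y$ at distance $i\le 2$, the number of walks of length $\ell$ from $x$ to $y$ depends only on $\ell$ and $i$. Eigenvalues of a graph are those of its adjacency matrix. A group divisible design $GDD(n,m;k;\lambda_1,\lambda_2)$ is a triple $(\mathcal P,\mathcal G,\mathcal B)$ consisting of a set $\mathcal P$ of points, a partition $\mathcal G$ of $\mathcal P$ into $m$ subsets of size $n$ (groups), and a collection $\mathcal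 B$ of $k$-subsets of $\mathcal P$ (blocks), such that each pair of distinct points from the same group appears in exactly $\lambda_1$ blocks and each pair of points from different groups appears in exactly $\lambda_2$ blocks. Its dual incidence structure has point set $\mathcal B$ and block set $\mathcal P$, where $p\in\mathcal P$ is identified with the set of blocks containing $p$. If there is a partition $\mathcal G'$ of $\mathcal B$ such that $(\mathcal B,\mathcal G',\mathcal P)$ is a $GDD(n,m;k;\lambda_1,\lambda_2)$ (same parameters), the design is called a group divisible design with the dual property, denoted $GDDDP(n,m;k;\lambda_1,\lambda_2)$. The point--block incidence graph has vertex set $\mathcal P\cup\mathcal B$ (disjoint union), with a point and a block adjacent iff they are incident, and no other adjacencies. *)

theory Defs
  imports
    "Graph_Theory.Graph_Theory"
    "Jordan_Normal_Form.Char_Poly"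
    "HOL-Library.Disjoint_Sets"
    "HOL-Combinatorics.Permutations"
begin

text \<open>
  A finite simple undirected graph is a \<^term>\<open>G :: 'a pair_pre_digraph\<close> with
  \<^term>\<open>pair_graph G\<close>: each undirected edge is represented by its two arcs.
\<close>

definition nbrs :: "'a pair_pre_digraph \<Rightarrow> 'a \<Rightarrow> 'a set" where
  "nbrs G x = {y. (x, y) \<in> parcs G}"

text \<open>The distance between vertices in different components is \<open>\<infinity>\<close>.\<close>

definition graph_dist :: "'a pair_pre_digraph \<Rightarrow> 'a \<Rightarrow> 'a \<Rightarrow> ereal" where
  "graph_dist G x y = wf_digraph.\<mu> (with_proj G) (\<lambda>_. 1) x y"

definition graph_diameter :: "'a pair_pre_digraph \<Rightarrow> ereal" where
  "graph_diameter G = (SUP x\<in>pverts G. SUP y\<in>pverts G. graph_dist G x y)"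

definition graph_connected :: "'a pair_pre_digraph \<Rightarrow> bool" where
  "graph_connected G \<longleftrightarrow> Digraph_Component.connected (with_proj G)"

definition bipartite :: "'a pair_pre_digraph \<Rightarrow> bool" where
  "bipartite G \<longleftrightarrow> (\<exists>U W. U \<union> W = pverts G \<and> U \<inter> W = {} \<and> parcs G \<subseteq> U \<times> W \<union> W \<times> U)"

definition amply_regular :: "'a pair_pre_digraph \<Rightarrow> nat \<Rightarrow> nat \<Rightarrow> nat \<Rightarrow> nat \<Rightarrow> bool" where
  "amply_regular G v k l m \<longleftrightarrow>
     card (pverts G) = v \<and>
     (\<forall>x\<in>pverts G. card (nbrs G x) = k) \<and>
     (\<forall>x\<in>pverts G. \<forall>y\<in>pverts G. (x, y) \<in> parcs G \<longrightarrow> card (nbrs G x \<inter> nbrs G y) = l) \<and>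
     (\<forall>x\<in>pverts G. \<forall>y\<in>pverts G. graph_dist G x y = 2 \<longrightarrow> card (nbrs G x \<inter> nbrs G y) = m)"


text \<open>The cells of a partition are indexed by \<open>0, \<dots>, n - 1\<close>.\<close>

definition equitable_partition ::
    "'a pair_pre_digraph \<Rightarrow> nat \<Rightarrow> (nat \<Rightarrow> 'a set) \<Rightarrow> (nat \<Rightarrow> nat \<Rightarrow> nat) \<Rightarrow> bool" where
  "equitable_partition G n B q \<longleftrightarrow>
     partition_on (pverts G) (B ` {..<n}) \<and> inj_on B {..<n} \<and>
     (\<forall>i<n. \<forall>j<n. \<forall>x\<in>B i. card (nbrs G x \<inter> B j) = q i j)"

definition distribution_diagram ::
    "'a pair_pre_digraph \<Rightarrow> nat \<Rightarrow> (nat \<Rightarrow> 'a set) \<Rightarrow> (nat \<Rightarrow> nat) \<Rightarrow> (nat \<Rightarrow> nat \<Rightarrow> nat) \<Rightarrow> bool" where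
  "distribution_diagram G n B s q \<longleftrightarrow>
     equitable_partition G n B q \<and> (\<forall>i<n. card (B i) = s i)"

text \<open>Cell 0 of the diagram is the one formed by the base vertex.\<close>

definition Q_regular ::
    "'a pair_pre_digraph \<Rightarrow> nat \<Rightarrow> (nat \<Rightarrow> nat) \<Rightarrow> (nat \<Rightarrow> nat \<Rightarrow> nat) \<Rightarrow> bool" where
  "Q_regular G n s q \<longleftrightarrow>
     (\<forall>x\<in>pverts G. \<exists>B. distribution_diagram G n B s q \<and> B 0 = {x})"

definition Qk_size :: "nat \<Rightarrow> nat \<Rightarrow> nat" where
  "Qk_size k i = [1, k, 2 * k, k, 1, 2] ! i"

text \<open>Only used for odd \<open>k\<close>, where \<^term>\<open>(k - 1) div 2\<close> is exact.\<close>

definition Qk_quot :: "nat \<Rightarrow> nat \<Rightarrow> nat \<Rightarrow> nat" where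
  "Qk_quot k i j =
    [[0, k, 0, 0, 0, 0],
     [1, 0, k - 1, 0, 0, 0],
     [0, (k - 1) div 2, 0, (k - 1) div 2, 0, 1],
     [0, 0, k - 1, 0, 1, 0],
     [0, 0, 0, k, 0, 0],
     [0, 0, k, 0, 0, 0]] ! i ! j"


text \<open>
  The 0/1 matrix of a relation on \<open>set xs\<close>, with rows and columns in the order of \<open>xs\<close>.
  The notions below do not depend on the chosen enumeration.
\<close>

definition rel_mat :: "'a list \<Rightarrow> 'a rel \<Rightarrow> 'b :: {zero, one} mat" where
  "rel_mat xs R = mat (length xs) (length xs) (\<lambda>(i, j). if (xs ! i, xs ! j) \<in> R then 1 else 0)"

definition mat_lincomb :: "nat \<Rightarrow> nat \<Rightarrow> (nat \<Rightarrow> real) \<Rightarrow> (nat \<Rightarrow> real mat) \<Rightarrow> real mat" where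
  "mat_lincomb N n c F = mat N N (\<lambda>ab. \<Sum>h\<le>n. c h * F h $$ ab)"

definition sym_assoc_scheme :: "nat \<Rightarrow> 'a set \<Rightarrow> (nat \<Rightarrow> 'a rel) \<Rightarrow> bool" where
  "sym_assoc_scheme n X R \<longleftrightarrow>
     finite X \<and>
     (\<forall>i\<le>n. R i \<subseteq> X \<times> X \<and> R i \<noteq> {}) \<and>
     (\<exists>xs F. distinct xs \<and> set xs = X \<and> (\<forall>i\<le>n. F i = rel_mat xs (R i)) \<and>
        (\<forall>i\<le>n. transpose_mat (F i) = F i) \<and>
        F 0 = 1\<^sub>m (card X) \<and>
        mat_lincomb (card X) n (\<lambda>_. 1) F = mat (card X) (card X) (\<lambda>_. 1) \<and>
        (\<forall>i\<le>n. \<forall>j\<le>n. \<exists>c. F i * F j = mat_lincomb (card X) n c F))"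

text \<open>
  The permutation \<open>\<sigma>\<close> matches the cells of the diagram with the relations; it fixes 0, so that
  the cell of the base vertex is matched with the identity relation.
\<close>

definition relation_graph_with_diagram ::
    "'a pair_pre_digraph \<Rightarrow> nat \<Rightarrow> (nat \<Rightarrow> nat) \<Rightarrow> (nat \<Rightarrow> nat \<Rightarrow> nat) \<Rightarrow> bool" where
  "relation_graph_with_diagram G n s q \<longleftrightarrow>
     (\<exists>X R i \<sigma>. sym_assoc_scheme n X R \<and> i \<in> {1..n} \<and> G = \<lparr>pverts = X, parcs = R i\<rparr> \<and>
        \<sigma> permutes {1..n} \<and>
        (\<forall>x\<in>X. distribution_diagram G (n + 1) (\<lambda>j. {y \<in> X. (x, y) \<in> R (\<sigma> j)}) s q))"


definition num_walks :: "'a pair_pre_digraph \<Rightarrow> nat \<Rightarrow> 'a \<Rightarrow> 'a \<Rightarrow> nat" where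
  "num_walks G l x y = card {p. pre_digraph.awalk (with_proj G) x p y \<and> length p = l}"

definition walk_regular :: "nat \<Rightarrow> 'a pair_pre_digraph \<Rightarrow> bool" where
  "walk_regular t G \<longleftrightarrow> graph_connected G \<and>
     (\<forall>l. \<forall>i\<le>t. \<exists>w. \<forall>x\<in>pverts G. \<forall>y\<in>pverts G.
        graph_dist G x y = ereal (real i) \<longrightarrow> num_walks G l x y = w)"

definition graph_eigenvalues :: "'a pair_pre_digraph \<Rightarrow> complex set" where
  "graph_eigenvalues G =
     {\<theta>. \<exists>xs. distinct xs \<and> set xs = pverts G \<and> eigenvalue (rel_mat xs (parcs G)) \<theta>}"


text \<open>
  The collection of blocks is a family of subsets of the points, indexed by \<open>\<B>\<close>: the block with
  label \<open>b\<close> is \<open>pts b\<close>. In this way the dual, whose blocks are labelled by points, is again of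
  the same form.
\<close>

definition gdd :: "'p set \<Rightarrow> 'p set set \<Rightarrow> 'b set \<Rightarrow> ('b \<Rightarrow> 'p set) \<Rightarrow>
    nat \<Rightarrow> nat \<Rightarrow> nat \<Rightarrow> nat \<Rightarrow> nat \<Rightarrow> bool" where
  "gdd \<P> \<G> \<B> pts n m k l1 l2 \<longleftrightarrow>
     finite \<P> \<and> finite \<B> \<and>
     partition_on \<P> \<G> \<and> card \<G> = m \<and> (\<forall>g\<in>\<G>. card g = n) \<and>
     (\<forall>b\<in>\<B>. pts b \<subseteq> \<P> \<and> card (pts b) = k) \<and>
     (\<forall>g\<in>\<G>. \<forall>p\<in>g. \<forall>q\<in>g. p \<noteq> q \<longrightarrow> card {b \<in> \<B>. p \<in> pts b \<and> q \<in> pts b} = l1) \<and>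
     (\<forall>g\<in>\<G>. \<forall>h\<in>\<G>. g \<noteq> h \<longrightarrow>
        (\<forall>p\<in>g. \<forall>q\<in>h. card {b \<in> \<B>. p \<in> pts b \<and> q \<in> pts b} = l2))"

definition gdddp :: "'p set \<Rightarrow> 'p set set \<Rightarrow> 'b set \<Rightarrow> ('b \<Rightarrow> 'p set) \<Rightarrow>
    nat \<Rightarrow> nat \<Rightarrow> nat \<Rightarrow> nat \<Rightarrow> nat \<Rightarrow> bool" where
  "gdddp \<P> \<G> \<B> pts n m k l1 l2 \<longleftrightarrow>
     gdd \<P> \<G> \<B> pts n m k l1 l2 \<and>
     (\<exists>\<G>'. gdd \<B> \<G>' \<P> (\<lambda>p. {b \<in> \<B>. p \<in> pts b}) n m k l1 l2)"

definition incidence_graph :: "'p set \<Rightarrow> 'b set \<Rightarrow> ('b \<Rightarrow> 'p set) \<Rightarrow> ('p + 'b) pair_pre_digraph" where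
  "incidence_graph \<P> \<B> pts =
     \<lparr>pverts = \<P> <+> \<B>,
      parcs = {(Inl p, Inr b) | p b. p \<in> \<P> \<and> b \<in> \<B> \<and> p \<in> pts b} \<union>
              {(Inr b, Inl p) | p b. p \<in> \<P> \<and> b \<in> \<B> \<and> p \<in> pts b}\<rparr>"

text \<open>
  Being an incidence graph is meant up to isomorphism. Taking points and block labels from the
  vertex type is no restriction, since both correspond to vertices of \<open>G\<close>.
\<close>

definition incidence_graph_of_gdddp ::
    "'a pair_pre_digraph \<Rightarrow> nat \<Rightarrow> nat \<Rightarrow> nat \<Rightarrow> nat \<Rightarrow> nat \<Rightarrow> bool" where
  "incidence_graph_of_gdddp G n m k l1 l2 \<longleftrightarrow>
     (\<exists>(\<P> :: 'a set) \<G> (\<B> :: 'a set) pts. gdddp \<P> \<G> \<B> pts n m k l1 l2 \<and>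
        digraph_iso (with_proj G) (with_proj (incidence_graph \<P> \<B> pts)))"

end

theory Submission
  imports Defs
begin

text \<open>
  All three conditions say that the graph is bipartite with halves of size \<open>2k + 2\<close>, that it
  is \<open>k\<close>-regular, and that every vertex \<open>x\<close> has an antipode \<open>\<tau> x\<close> in its half such
  that \<open>x\<close> and \<open>\<tau> x\<close> have no common neighbour, while \<open>x\<close> and any other vertex of the half
  have \<open>\<mu> = (k - 1) / 2\<close> common neighbours. In matrix form
  \<open>A\<^sup>2 = k I + \<mu> (E - I - T)\<close>, where \<open>T\<close> is the matrix of \<open>\<tau>\<close> and \<open>E\<close> that of lying in
  the same half. Comparing \<open>A A\<^sup>2\<close> with \<open>A\<^sup>2 A\<close> gives \<open>A T = T A\<close>, so \<open>\<tau>\<close> is an automorphism; the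
  cells of \<open>\<Q>\<^sub>k\<close> around \<open>x\<close> are then \<open>{x}\<close>, \<open>N x\<close>, the rest of the half of \<open>x\<close>, \<open>N (\<tau> x)\<close>,
  \<open>{\<tau> x}\<close> and the rest of the other half. The corresponding relations are symmetric, and
  since each of their matrices is a polynomial in \<open>A\<close>, they form an association scheme. The
  equation for \<open>A\<^sup>2\<close> also yields the eigenvalues \<open>\<plusminus>k\<close>, \<open>\<plusminus>\<surd>k\<close> and \<open>\<plusminus>1\<close>.
\<close>

lemma pair_graph_nbrs:
  assumes "pair_graph G"
  shows finite_pverts: "finite (pverts G)"
    and nbrs_subset: "nbrs G x \<subseteq> pverts G"
    and nbrs_sym: "y \<in> nbrs G x \<longleftrightarrow> x \<in> nbrs G y"
    and finite_nbrs: "finite (nbrs G x)"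
proof -
  interpret pair_graph G by fact
  show f: "finite (pverts G)" by (rule pair_finite_verts)
  show s: "nbrs G x \<subseteq> pverts G" by (auto simp: nbrs_def dest: in_arcsD2)
  show "y \<in> nbrs G x \<longleftrightarrow> x \<in> nbrs G y"
    using pair_sym_arcs by (auto simp: nbrs_def symmetric_def sym_def)
  show "finite (nbrs G x)" using f s finite_subset by blast
qed

lemma sum_count_commute:
  assumes "finite A" "finite B"
  shows "(\<Sum>x\<in>A. card {y\<in>B. P x y}) = (\<Sum>y\<in>B. card {x\<in>A. P x y})"
  using sum.swap_restrict[OF assms, of "\<lambda>_ _. 1::nat" P] by simp

section \<open>Bipartite graphs of group divisible designs with groups of size two\<close>

text \<open>\<open>s\<close> is the two-colouring, and \<open>half\<close> covers both colours
  through the free \<open>b\<close>. That \<open>\<tau>\<close> is an involution and preserves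
  adjacency is derived, in \<open>tau_tau\<close> and \<open>adj_tau\<close>.\<close>

locale divisible_bipartite =
  fixes G :: "'a pair_pre_digraph" and s :: "'a \<Rightarrow> bool" and \<tau> :: "'a \<Rightarrow> 'a" and k m :: nat
  assumes graph: "pair_graph G"
    and k_eq: "k = 2 * m + 1" and m_ge2: "m \<ge> 2"
    and side: "y \<in> nbrs G x \<Longrightarrow> s y \<noteq> s x"
    and half: "card {y \<in> pverts G. s y = b} = 2 * k + 2"
    and deg: "x \<in> pverts G \<Longrightarrow> card (nbrs G x) = k"
    and tau_in: "x \<in> pverts G \<Longrightarrow> \<tau> x \<in> pverts G"
    and tau_side: "x \<in> pverts G \<Longrightarrow> s (\<tau> x) = s x"
    and tau_ne: "x \<in> pverts G \<Longrightarrow> \<tau> x \<noteq> x"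
    and tau_disj: "x \<in> pverts G \<Longrightarrow> nbrs G x \<inter> nbrs G (\<tau> x) = {}"
    and common: "\<lbrakk>x \<in> pverts G; y \<in> pverts G; s y = s x; y \<noteq> x; y \<noteq> \<tau> x\<rbrakk>
      \<Longrightarrow> card (nbrs G x \<inter> nbrs G y) = m"
begin

abbreviation "V \<equiv> pverts G"
abbreviation "N \<equiv> nbrs G"

lemmas finV [simp] = finite_pverts[OF graph]
lemmas finN [simp] = finite_nbrs[OF graph]
lemmas NV = nbrs_subset[OF graph]
lemmas Nsym = nbrs_sym[OF graph]

text \<open>Otherwise \<open>x\<close> would be neither \<open>\<tau> x\<close> nor its antipode, so
  \<open>common\<close> would give these two \<open>m > 0\<close> common neighbours, against
  \<open>tau_disj\<close>.\<close>

lemma tau_tau: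
  assumes "x \<in> V"
  shows "\<tau> (\<tau> x) = x"
proof (rule ccontr)
  assume "\<tau> (\<tau> x) \<noteq> x"
  then have "card (N (\<tau> x) \<inter> N x) = m"
    using assms tau_in tau_side tau_ne[of x] by (intro common) metis+
  then show False using tau_disj[OF assms] m_ge2 by (simp add: Int_commute)
qed

lemma tau_eq_iff: "x \<in> V \<Longrightarrow> y \<in> V \<Longrightarrow> y = \<tau> x \<longleftrightarrow> x = \<tau> y"
  using tau_tau by metis

text \<open>These are the entries of \<open>A\<^sup>2\<close> inside a half, as a constant with
  corrections at \<open>x\<close> and \<open>\<tau> x\<close>, so that sums over \<open>z\<close>
  split. Integers keep the subtraction at \<open>\<tau> x\<close> exact.\<close>

lemma common_eq:
  assumes "x \<in> V" "z \<in> V" "s z = s x"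
  shows "int (card (N x \<inter> N z)) =
    int m + (if z = x then int k - int m else 0) - (if z = \<tau> x then int m else 0)"
proof -
  consider "z = x" | "z = \<tau> x" | "z \<noteq> x" "z \<noteq> \<tau> x" by blast
  then show ?thesis
    using tau_disj[OF assms(1)] tau_ne[OF assms(1)] deg[OF assms(1)] common[OF assms]
    by cases simp_all
qed

text \<open>An entry of \<open>A\<^sup>3\<close>: all of \<open>N y\<close> lies in the half of
  \<open>x\<close>, where \<open>common_eq\<close> applies to each of the \<open>k\<close>
  summands.\<close>

lemma walks3:
  assumes x: "x \<in> V" and y: "y \<in> V" and ne: "s x \<noteq> s y"
  shows "(\<Sum>z\<in>N y. int (card (N x \<inter> N z))) =
    int k * int m + (if x \<in> N y then int k - int m else 0) - (if \<tau> x \<in> N y then int m else 0)"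
proof -
  have "(\<Sum>z\<in>N y. int (card (N x \<inter> N z))) =
    (\<Sum>z\<in>N y. int m + (if z = x then int k - int m else 0) - (if z = \<tau> x then int m else 0))"
    using NV[of y] side[of _ y] ne x by (intro sum.cong common_eq) auto
  then show ?thesis using deg[OF y] by (simp add: sum.distrib sum_subtractf)
qed

text \<open>Counting the walks of length three between \<open>x\<close> and \<open>y\<close> from either end shows that
  the antipodal map is an automorphism.\<close>

lemma adj_tau:
  assumes x: "x \<in> V" and y: "y \<in> V"
  shows "y \<in> N (\<tau> x) \<longleftrightarrow> \<tau> y \<in> N x"
proof (cases "s x = s y")
  case True
  then show ?thesis using side[of y "\<tau> x"] side[of "\<tau> y" x] tau_side x y by metis
next
  case False
  have "(\<Sum>z\<in>N y. card (N x \<inter> N z)) = (\<Sum>z\<in>N y. card {w\<in>N x. w \<in> N z})"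
    by (simp add: Int_def)
  also have "\<dots> = (\<Sum>w\<in>N x. card {z\<in>N y. w \<in> N z})"
    by (rule sum_count_commute) simp_all
  also have "\<dots> = (\<Sum>w\<in>N x. card (N y \<inter> N w))"
  proof -
    have "{z\<in>N y. w \<in> N z} = N y \<inter> N w" for w by (auto simp: Nsym[where y = w])
    then show ?thesis by simp
  qed
  finally have "(\<Sum>z\<in>N y. int (card (N x \<inter> N z))) = (\<Sum>w\<in>N x. int (card (N y \<inter> N w)))"
    by (simp flip: of_nat_sum)
  \<comment> \<open>Adjacency of \<open>x\<close> and \<open>y\<close> is symmetric, so comparing
    the two evaluations of the count leaves only the antipodal corrections.\<close>
  then have "(if \<tau> x \<in> N y then int m else 0) = (if \<tau> y \<in> N x then int m else 0)"
    using walks3[OF x y False] walks3[OF y x] False Nsym[of x y] by (auto split: if_splits)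
  then show ?thesis using m_ge2 Nsym[of "\<tau> x" y] by (simp split: if_splits)
qed

text \<open>The relations of the association scheme, numbered like the cells of \<open>\<Q>\<^sub>k\<close>.\<close>

definition cls :: "'a \<Rightarrow> 'a \<Rightarrow> nat" where
  "cls x y = (if s x = s y then if y = x then 0 else if y = \<tau> x then 4 else 2
    else if y \<in> N x then 1 else if y \<in> N (\<tau> x) then 3 else 5)"

lemma cls_less: "cls x y < 6"
  by (simp add: cls_def)

text \<open>Class 4 is symmetric because \<open>\<tau>\<close> is an involution, class 3 because of
  \<open>adj_tau\<close>; the remaining classes then follow.\<close>

lemma cls_commute: "x \<in> V \<Longrightarrow> y \<in> V \<Longrightarrow> cls x y = cls y x"
  using tau_eq_iff[of x y] adj_tau[of x y] Nsym[of "\<tau> y" x] Nsym[of y x]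
  by (simp add: cls_def eq_commute[of x y] eq_commute[of "s x"])

lemma cls_cells:
  assumes x: "x \<in> V"
  shows "{z\<in>V. cls x z = 0} = {x}"
    and "{z\<in>V. cls x z = 1} = N x"
    and "{z\<in>V. cls x z = 2} = {z\<in>V. s z = s x} - {x, \<tau> x}"
    and "{z\<in>V. cls x z = 3} = N (\<tau> x)"
    and "{z\<in>V. cls x z = 4} = {\<tau> x}"
    and "{z\<in>V. cls x z = 5} = {z\<in>V. s z = (\<not> s x)} - (N x \<union> N (\<tau> x))"
proof -
  have N1: "z \<in> N x \<Longrightarrow> z \<in> V \<and> s x \<noteq> s z \<and> z \<notin> N (\<tau> x)"
    and N2: "z \<in> N (\<tau> x) \<Longrightarrow> z \<in> V \<and> s x \<noteq> s z" for z
    using NV[of x] NV[of "\<tau> x"] side[of z x] side[of z "\<tau> x"] tau_disj[OF x] tau_side[OF x]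
    by blast+
  have c0: "z \<in> V \<and> cls x z = 0 \<longleftrightarrow> z = x"
    and c1: "z \<in> V \<and> cls x z = 1 \<longleftrightarrow> z \<in> N x"
    and c2: "z \<in> V \<and> cls x z = 2 \<longleftrightarrow> z \<in> V \<and> s z = s x \<and> z \<noteq> x \<and> z \<noteq> \<tau> x"
    and c3: "z \<in> V \<and> cls x z = 3 \<longleftrightarrow> z \<in> N (\<tau> x)"
    and c4: "z \<in> V \<and> cls x z = 4 \<longleftrightarrow> z = \<tau> x"
    and c5: "z \<in> V \<and> cls x z = 5 \<longleftrightarrow>
      z \<in> V \<and> s z = (\<not> s x) \<and> z \<notin> N x \<and> z \<notin> N (\<tau> x)" for z
    unfolding cls_def
    using x tau_in[OF x] tau_side[OF x] tau_ne[OF x] N1[of z] N2[of z]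
    by (cases "s x"; cases "s z"; simp; blast?)+
  show "{z\<in>V. cls x z = 0} = {x}" "{z\<in>V. cls x z = 1} = N x"
    "{z\<in>V. cls x z = 2} = {z\<in>V. s z = s x} - {x, \<tau> x}"
    "{z\<in>V. cls x z = 3} = N (\<tau> x)" "{z\<in>V. cls x z = 4} = {\<tau> x}"
    "{z\<in>V. cls x z = 5} = {z\<in>V. s z = (\<not> s x)} - (N x \<union> N (\<tau> x))"
    unfolding c0 c1 c2 c3 c4 c5 by blast+
qed

lemma less_6_cases: "i < 6 \<Longrightarrow> i = 0 \<or> i = 1 \<or> i = 2 \<or> i = 3 \<or> i = 4 \<or> i = (5::nat)"
  by auto

text \<open>Cells 2 and 5 are what remains of a half of size \<open>2 * k + 2\<close> after removing
  two vertices, respectively the two disjoint \<open>k\<close>-sets \<open>N x\<close> and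
  \<open>N (\<tau> x)\<close>.\<close>

lemma card_cell:
  assumes x: "x \<in> V" and i: "i < 6"
  shows "card {z\<in>V. cls x z = i} = Qk_size k i"
proof -
  have "card ({z\<in>V. s z = s x} - {x, \<tau> x}) = 2 * k"
    using x tau_in[OF x] tau_side[OF x] tau_ne[OF x] half[of "s x"]
    by (subst card_Diff_subset) auto
  moreover have "card ({z\<in>V. s z = (\<not> s x)} - (N x \<union> N (\<tau> x))) = 2"
  proof (subst card_Diff_subset)
    show "N x \<union> N (\<tau> x) \<subseteq> {z\<in>V. s z = (\<not> s x)}"
      using NV side[of _ x] side[of _ "\<tau> x"] tau_side[OF x] by auto
    show "card {z\<in>V. s z = (\<not> s x)} - card (N x \<union> N (\<tau> x)) = 2"
      using half[of "\<not> s x"] deg[OF x] deg[OF tau_in[OF x]] tau_disj[OF x]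
      by (simp add: card_Un_disjoint)
  qed simp
  ultimately show ?thesis
    using less_6_cases[OF i] deg[OF x] deg[OF tau_in[OF x]]
    by (elim disjE) (simp_all only: cls_cells[OF x], simp_all add: Qk_size_def)
qed

text \<open>If \<open>y\<close> is in the half of \<open>x\<close>, then \<open>N y\<close> splits
  along \<open>N x\<close>, \<open>N (\<tau> x)\<close> and cell 5; for \<open>y\<close> in cell 2
  the parts have sizes \<open>m\<close>, \<open>m\<close> and \<open>k - 2 * m = 1\<close>. If not,
  \<open>N y\<close> lies in the half of \<open>x\<close>, and only the membership of
  \<open>x\<close> and \<open>\<tau> x\<close> matters.\<close>

lemma card_nbrs_cell:
  assumes x: "x \<in> V" and y: "y \<in> V" and j: "j < 6"
  shows "card (N y \<inter> {z\<in>V. cls x z = j}) = Qk_quot k (cls x y) j"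
proof (cases "s y = s x")
  case True
  have cross: "N y \<inter> {z\<in>V. cls x z = j} = {}" if "j = 0 \<or> j = 2 \<or> j = 4"
    using that side[where x = y] True by (elim disjE) (simp_all add: cls_def disjoint_iff)
  have "N y - N x - N (\<tau> x) = N y \<inter> ({z\<in>V. s z = (\<not> s x)} - (N x \<union> N (\<tau> x)))"
    using NV[of y] side[of _ y] True by auto
  moreover have "card (N y - N x - N (\<tau> x)) = k - card (N y \<inter> N x) - card (N y \<inter> N (\<tau> x))"
  proof -
    have "N y - N x - N (\<tau> x) = N y - ((N y \<inter> N x) \<union> (N y \<inter> N (\<tau> x)))" by auto
    moreover have "card ((N y \<inter> N x) \<union> (N y \<inter> N (\<tau> x))) =
        card (N y \<inter> N x) + card (N y \<inter> N (\<tau> x))"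
      using tau_disj[OF x] by (intro card_Un_disjoint) auto
    ultimately show ?thesis using deg[OF y] by (simp only:) (subst card_Diff_subset, auto)
  qed
  moreover have "card (N y \<inter> N x) = Qk_quot k (cls x y) 1"
      and "card (N y \<inter> N (\<tau> x)) = Qk_quot k (cls x y) 3"
    using True x y deg[OF x] deg[OF y] tau_disj[OF x] common[OF x y] common[OF tau_in[OF x] y]
      tau_tau[OF x] tau_side[OF x] tau_ne[OF x] k_eq
    by (auto simp: cls_def Qk_quot_def Int_commute)
  moreover have "cls x y = 0 \<or> cls x y = 4 \<or> cls x y = 2"
    using True by (simp add: cls_def)
  ultimately show ?thesis
    using less_6_cases[OF j] cross k_eq
    by (elim disjE) (simp_all only: cls_cells[OF x], simp_all add: Qk_quot_def)
next
  case False
  have cross: "N y \<inter> {z\<in>V. cls x z = j} = {}" if "j = 1 \<or> j = 3 \<or> j = 5"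
    using that side[where x = y] False by (elim disjE) (simp_all add: cls_def disjoint_iff)
  have eq: "N y \<inter> ({z\<in>V. s z = s x} - {x, \<tau> x}) = N y - {x, \<tau> x}"
    using NV[of y] side[of _ y] False by auto
  \<comment> \<open>Otherwise \<open>y\<close> would be a common neighbour of \<open>x\<close> and
    its antipode. Hence \<open>N y\<close> loses at most one element.\<close>
  have "x \<in> N y \<Longrightarrow> \<tau> x \<notin> N y"
    using tau_disj[OF x] Nsym[of x y] Nsym[of "\<tau> x" y] by auto
  then have "card (N y - {x, \<tau> x}) = (if x \<in> N y \<or> \<tau> x \<in> N y then k - 1 else k)"
    using deg[OF y] by (subst card_Diff_subset_Int) (auto simp: Int_insert_right)
  moreover have "x \<in> N y \<Longrightarrow> \<tau> x \<notin> N y"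
    using tau_disj[OF x] Nsym[of x y] Nsym[of "\<tau> x" y] by auto
  moreover have "cls x y = (if x \<in> N y then 1 else if \<tau> x \<in> N y then 3 else 5)"
    using False Nsym[of x y] Nsym[of "\<tau> x" y] by (simp add: cls_def)
  ultimately show ?thesis
    using less_6_cases[OF j] cross k_eq
    by (elim disjE) (simp_all only: cls_cells[OF x] eq, simp_all add: Qk_quot_def)
qed


lemma diagram:
  assumes x: "x \<in> V"
  shows "distribution_diagram G 6 (\<lambda>j. {z\<in>V. cls x z = j}) (Qk_size k) (Qk_quot k)"
proof -
  let ?B = "\<lambda>j. {z\<in>V. cls x z = j}"
  \<comment> \<open>Nonemptiness is required by \<open>partition_on\<close> and also makes cells
    with different indices different sets.\<close>
  have ne: "?B j \<noteq> {}" if "j < 6" for j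
  proof -
    have "0 < Qk_size k j"
      using less_6_cases[OF that] k_eq by (elim disjE) (simp_all add: Qk_size_def)
    then show ?thesis using card_cell[OF x that] by force
  qed
  have "partition_on V (?B ` {..<6})"
  proof (rule partition_onI)
    show "\<Union> (?B ` {..<6}) = V" using cls_less by auto
    show "{} \<notin> ?B ` {..<6}" using ne by blast
    show "disjnt p q" if "p \<in> ?B ` {..<6}" "q \<in> ?B ` {..<6}" "p \<noteq> q" for p q
      using that by (auto simp: disjnt_def)
  qed
  moreover have "inj_on ?B {..<6}"
    by (rule inj_onI) (use ne in blast)
  ultimately show ?thesis
    using card_nbrs_cell[OF x] card_cell[OF x]
    by (simp add: distribution_diagram_def equitable_partition_def)
qed

section \<open>Functions of the class and multiplication by the adjacency matrix\<close>

definition step :: "(nat \<Rightarrow> 'b) \<Rightarrow> nat \<Rightarrow> 'b :: comm_semiring_1" where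
  "step g i = (\<Sum>j<6. of_nat (Qk_quot k i j) * g j)"

text \<open>Grouping \<open>N y\<close> by class replaces the sum by a row of the quotient matrix.
  The result type stays polymorphic because real matrices and natural walk counts both use
  it.\<close>

lemma sum_nbrs_cls:
  assumes x: "x \<in> V" and y: "y \<in> V"
  shows "(\<Sum>z\<in>N y. g (cls x z)) = step g (cls x y)"
proof -
  have "(\<Sum>z\<in>N y. g (cls x z)) = (\<Sum>j<6. \<Sum>z\<in>{z\<in>N y. cls x z = j}. g (cls x z))"
    using cls_less by (intro sum.group[symmetric]) auto
  also have "\<dots> = (\<Sum>j<6. of_nat (card {z\<in>N y. cls x z = j}) * g j)"
    by simp
  also have "\<dots> = (\<Sum>j<6. of_nat (Qk_quot k (cls x y) j) * g j)"
  proof (rule sum.cong[OF refl])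
    fix j :: nat assume j: "j \<in> {..<6}"
    have "{z\<in>N y. cls x z = j} = N y \<inter> {z\<in>V. cls x z = j}" using NV[of y] by blast
    then show "of_nat (card {z\<in>N y. cls x z = j}) * g j = of_nat (Qk_quot k (cls x y) j) * g j"
      using card_nbrs_cell[OF x y] j by simp
  qed
  finally show ?thesis by (simp add: step_def)
qed

text \<open>Matrices whose entries depend only on the class of the index pair are identified with
  functions on classes; \<open>composable g\<close> says that the product of the matrix \<open>g\<close> with any other
  such matrix is again of this form. Left multiplication by the adjacency matrix is
  \<^const>\<open>step\<close>, and since every class is a polynomial in the adjacency matrix, every \<open>g\<close> is
  composable.\<close>

definition composable :: "(nat \<Rightarrow> real) \<Rightarrow> bool" where
  "composable g \<longleftrightarrow>
    (\<forall>f. \<exists>c. \<forall>x\<in>V. \<forall>y\<in>V. (\<Sum>z\<in>V. g (cls x z) * f (cls z y)) = c (cls x y))"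

lemma composable_cong:
  assumes "composable g" "\<And>i. i < 6 \<Longrightarrow> g i = h i"
  shows "composable h"
  using assms cls_less by (simp add: composable_def)

lemma composable_lincomb:
  assumes "composable g" "composable h"
  shows "composable (\<lambda>i. a * g i + b * h i)"
  unfolding composable_def
proof
  fix f
  obtain c where c: "\<And>x y. x \<in> V \<Longrightarrow> y \<in> V \<Longrightarrow> (\<Sum>z\<in>V. g (cls x z) * f (cls z y)) = c (cls x y)"
    using assms(1) unfolding composable_def by metis
  obtain d where d: "\<And>x y. x \<in> V \<Longrightarrow> y \<in> V \<Longrightarrow> (\<Sum>z\<in>V. h (cls x z) * f (cls z y)) = d (cls x y)"
    using assms(2) unfolding composable_def by metis
  have "(\<Sum>z\<in>V. (a * g (cls x z) + b * h (cls x z)) * f (cls z y)) =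
      a * c (cls x y) + b * d (cls x y)" if "x \<in> V" "y \<in> V" for x y
    unfolding c[OF that, symmetric] d[OF that, symmetric] sum_distrib_left sum.distrib[symmetric]
    by (simp add: algebra_simps)
  then show "\<exists>c. \<forall>x\<in>V. \<forall>y\<in>V.
      (\<Sum>z\<in>V. (a * g (cls x z) + b * h (cls x z)) * f (cls z y)) = c (cls x y)"
    by (intro exI[of _ "\<lambda>i. a * c i + b * d i"]) blast
qed

text \<open>Associativity: \<open>(A g) f = A (g f)\<close>, and \<open>g f\<close> is a function
  \<open>c\<close> of the class, so that \<open>A (g f)\<close> is \<open>step c\<close>. Symmetry
  of \<open>cls\<close> lets the sum over neighbours run in either argument.\<close>

lemma composable_step:
  assumes "composable g"
  shows "composable (step g)"
  unfolding composable_def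
proof
  fix f
  obtain c where c: "\<And>x y. x \<in> V \<Longrightarrow> y \<in> V \<Longrightarrow> (\<Sum>z\<in>V. g (cls x z) * f (cls z y)) = c (cls x y)"
    using assms(1) unfolding composable_def by metis
  have "(\<Sum>z\<in>V. step g (cls x z) * f (cls z y)) = step c (cls x y)"
    if x: "x \<in> V" and y: "y \<in> V" for x y
  proof -
    have *: "step g (cls x z) = (\<Sum>w\<in>N x. g (cls w z))" if z: "z \<in> V" for z
    proof -
      have "(\<Sum>w\<in>N x. g (cls w z)) = (\<Sum>w\<in>N x. g (cls z w))"
        using cls_commute[OF z] NV[of x] by (intro sum.cong refl arg_cong[of _ _ g]) auto
      then show ?thesis using sum_nbrs_cls[OF z x, of g] cls_commute[OF x z] by simp
    qed
    have "(\<Sum>z\<in>V. step g (cls x z) * f (cls z y)) =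
        (\<Sum>z\<in>V. \<Sum>w\<in>N x. g (cls w z) * f (cls z y))"
      by (simp add: * sum_distrib_right)
    also have "\<dots> = (\<Sum>w\<in>N x. \<Sum>z\<in>V. g (cls w z) * f (cls z y))"
      by (rule sum.swap)
    also have "\<dots> = (\<Sum>w\<in>N x. c (cls y w))"
      using c y NV[of x] cls_commute[OF y] by (intro sum.cong) auto
    finally show ?thesis using sum_nbrs_cls[OF y x, of c] cls_commute[OF x y] by simp
  qed
  then show "\<exists>c. \<forall>x\<in>V. \<forall>y\<in>V. (\<Sum>z\<in>V. step g (cls x z) * f (cls z y)) = c (cls x y)"
    by blast
qed

abbreviation ind :: "nat \<Rightarrow> nat \<Rightarrow> real" where
  "ind i \<equiv> \<lambda>j. if j = i then 1 else 0"

text \<open>With \<open>A_i\<close> the matrix of class \<open>i\<close>, the quotient matrix gives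
  \<open>A A_0 = A_1\<close>, \<open>A A_1 = k A_0 + m A_2\<close>,
  \<open>A A_2 = (k - 1) A_1 + (k - 1) A_3 + k A_5\<close> and \<open>A A_4 = A_3\<close>. Solving
  in turn yields the classes in the order 0, 1, 2, 4, 3, 5.\<close>

lemma composable_ind:
  assumes "i < 6"
  shows "composable (ind i)"
proof -
  \<comment> \<open>The third fact says that \<open>2 * m * k\<close> is nonzero, with
    \<open>k\<close> expanded as \<open>2 * m + 1\<close>; it lets denominators be cleared.\<close>
  have m: "real m > 0" "real k > 0" "real m * 2 + real m * (real m * 4) \<noteq> 0"
    and kr: "real k = 2 * real m + 1" "real (k - 1) = 2 * real m" "(k - 1) div 2 = m"
    using k_eq m_ge2 by (simp_all add: add_pos_pos[THEN less_imp_neq, symmetric])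
  note ev = step_def Qk_quot_def lessThan_Suc numeral_eq_Suc
  have 0: "composable (ind 0)"
    unfolding composable_def
  proof
    fix f
    have "(\<Sum>z\<in>V. ind 0 (cls x z) * f (cls z y)) = f (cls x y)" if "x \<in> V" for x y
    proof -
      have "cls x z = 0 \<longleftrightarrow> z = x" if "z \<in> V" for z
        using cls_cells(1)[OF \<open>x \<in> V\<close>] that by (auto simp: set_eq_iff)
      then have "(\<Sum>z\<in>V. ind 0 (cls x z) * f (cls z y)) =
          (\<Sum>z\<in>V. if z = x then f (cls x y) else 0)"
        by (intro sum.cong) auto
      then show ?thesis using that by simp
    qed
    then show "\<exists>c. \<forall>x\<in>V. \<forall>y\<in>V. (\<Sum>z\<in>V. ind 0 (cls x z) * f (cls z y)) = c (cls x y)"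
      by blast
  qed
  have 1: "composable (ind 1)"
    by (rule composable_cong[OF composable_step[OF 0]])
      (drule less_6_cases, elim disjE; simp add: ev)
  have 2: "composable (ind 2)"
    by (rule composable_cong[OF composable_lincomb[OF composable_step[OF 1] 0,
            where a = "1 / m" and b = "- (k / m)"]])
      (insert m kr, drule less_6_cases, elim disjE; simp add: ev field_simps)
  \<comment> \<open>\<open>A A_2\<close> yields classes 3 and 5 only in this combination; they are
    separated once class 4 is known.\<close>
  have 35: "composable (\<lambda>i. (k - 1) * ind 3 i + k * ind 5 i)"
    by (rule composable_cong[OF composable_lincomb[OF composable_step[OF 2] 1,
            where a = 1 and b = "- (real k - 1)"]])
      (insert m kr, drule less_6_cases, elim disjE; simp add: ev field_simps)
  \<comment> \<open>Applying \<open>A\<close> to the combination gives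
    \<open>k * (k - 1) = 2 * m * k\<close> at class 4 and
    \<open>m * (k - 1) + k = 2 * m * m + k\<close> at class 2.\<close>
  have 4: "composable (ind 4)"
    by (rule composable_cong[OF composable_lincomb[OF composable_step[OF 35] 2,
            where a = "1 / (2 * m * k)" and b = "- ((2 * m * m + k) / (2 * m * k))"]])
      (insert m kr, drule less_6_cases, elim disjE; simp add: ev field_simps)
  have 3: "composable (ind 3)"
    by (rule composable_cong[OF composable_step[OF 4]])
      (drule less_6_cases, elim disjE; simp add: ev)
  have 5: "composable (ind 5)"
    by (rule composable_cong[OF composable_lincomb[OF 35 3,
            where a = "1 / k" and b = "- ((k - 1) / k)"]])
      (insert m kr, drule less_6_cases, elim disjE; simp add: field_simps)
  from 0 1 2 3 4 5 less_6_cases[OF assms] show ?thesis by blast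
qed

end

section \<open>Matrices of the classes and the association scheme\<close>

lemma index_rel_mat:
  assumes "a < length xs" "b < length xs"
  shows "rel_mat xs R $$ (a, b) = (if (xs ! a, xs ! b) \<in> R then 1 else 0)"
  using assms by (simp add: rel_mat_def)

lemma rel_mat_carrier: "rel_mat xs R \<in> carrier_mat (length xs) (length xs)"
  by (simp add: rel_mat_def)

lemma sum_nth_distinct:
  assumes "distinct xs"
  shows "(\<Sum>i<length xs. g (xs ! i)) = (\<Sum>x\<in>set xs. g x)"
  using bij_betw_nth[OF assms refl refl] by (rule sum.reindex_bij_betw)

context divisible_bipartite begin

definition rels :: "nat \<Rightarrow> 'a rel" where
  "rels i = {(x, y). x \<in> V \<and> y \<in> V \<and> cls x y = i}"

lemma parcs_eq: "parcs G = rels 1"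
proof -
  have "(x, y) \<in> parcs G \<longleftrightarrow> y \<in> N x" for x y by (simp add: nbrs_def)
  moreover have "y \<in> N x \<longleftrightarrow> x \<in> V \<and> y \<in> V \<and> cls x y = 1" for x y
    using cls_cells(2)[of x] NV[of y] Nsym[of y x] by blast
  ultimately show ?thesis by (auto simp: rels_def)
qed

lemma V_nonempty: "V \<noteq> {}"
  using half[of True] by force

text \<open>Closure under products is \<open>composable_ind\<close> read entry by entry; the other
  axioms say that the classes are symmetric and partition the pairs, with class 0 the
  identity.\<close>

lemma scheme: "sym_assoc_scheme 5 V rels"
proof -
  obtain xs where xs: "distinct xs" "set xs = V"
    using finite_distinct_list[OF finV] by blast
  define n where "n = card V"
  have n: "length xs = n" using xs distinct_card n_def by metis
  define F :: "nat \<Rightarrow> real mat" where "F i = rel_mat xs (rels i)" for i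
  have Fdim: "F i \<in> carrier_mat n n" for i
    using rel_mat_carrier n by (auto simp: F_def)
  have inV: "a < n \<Longrightarrow> xs ! a \<in> V" for a using xs(2) n nth_mem by blast
  have F: "F i $$ (a, b) = ind i (cls (xs ! a) (xs ! b))" if "a < n" "b < n" for i a b
    using that n inV by (simp add: F_def index_rel_mat rels_def)
  \<comment> \<open>Each pair has exactly one class, so the coefficients are the entries themselves:
    linear combinations of the \<open>F i\<close> are exactly the matrices that depend only on the
    class.\<close>
  have lincomb: "mat_lincomb n 5 c F = mat n n (\<lambda>(a, b). c (cls (xs ! a) (xs ! b)))" for c
  proof -
    have "(\<Sum>h\<le>5. c h * F h $$ (a, b)) = c (cls (xs ! a) (xs ! b))" if "a < n" "b < n" for a b
    proof -
      have "(\<Sum>h\<le>5. c h * F h $$ (a, b)) =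
          (\<Sum>h\<le>5. if h = cls (xs ! a) (xs ! b) then c (cls (xs ! a) (xs ! b)) else 0)"
        using F[OF that] by (intro sum.cong) auto
      then show ?thesis using cls_less[of "xs ! a" "xs ! b"] by simp
    qed
    then show ?thesis by (intro eq_matI) (auto simp: mat_lincomb_def)
  qed
  have prod: "\<exists>c. F i * F j = mat_lincomb n 5 c F" if "i \<le> 5" "j \<le> 5" for i j
  proof -
    have "i < 6" using that by simp
    from composable_ind[OF this, unfolded composable_def, THEN spec, of "ind j"]
    obtain c where c: "\<And>x y. x \<in> V \<Longrightarrow> y \<in> V \<Longrightarrow>
        (\<Sum>z\<in>V. ind i (cls x z) * ind j (cls z y)) = c (cls x y)"
      by blast
    have "(F i * F j) $$ (a, b) = c (cls (xs ! a) (xs ! b))" if ab: "a < n" "b < n" for a b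
    proof -
      have "(F i * F j) $$ (a, b) = (\<Sum>l<n. F i $$ (a, l) * F j $$ (l, b))"
        using Fdim[of i] Fdim[of j] ab
        by (simp add: scalar_prod_def row_def col_def atLeast0LessThan)
      also have "\<dots> = (\<Sum>l<n. ind i (cls (xs ! a) (xs ! l)) * ind j (cls (xs ! l) (xs ! b)))"
        using ab by (intro sum.cong) (simp_all add: F)
      also have "\<dots> = (\<Sum>z\<in>V. ind i (cls (xs ! a) z) * ind j (cls z (xs ! b)))"
        using sum_nth_distinct[OF xs(1), of "\<lambda>z. ind i (cls (xs ! a) z) * ind j (cls z (xs ! b))"]
          n xs(2) by simp
      finally show ?thesis using c inV ab by simp
    qed
    then have "F i * F j = mat_lincomb n 5 c F"
      unfolding lincomb using Fdim[of i] Fdim[of j] by (intro eq_matI) auto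
    then show ?thesis by blast
  qed
  have "transpose_mat (F i) = F i" for i
    using Fdim[of i] by (intro eq_matI) (auto simp: F cls_commute[OF inV inV])
  moreover have "F 0 = 1\<^sub>m n"
  proof (rule eq_matI)
    fix a b assume "a < dim_row (1\<^sub>m n :: real mat)" "b < dim_col (1\<^sub>m n :: real mat)"
    then have ab: "a < n" "b < n" by auto
    have "cls (xs ! a) (xs ! b) = 0 \<longleftrightarrow> xs ! b = xs ! a"
      using cls_cells(1)[OF inV[OF ab(1)]] inV[OF ab(2)] by (auto simp: set_eq_iff)
    then show "F 0 $$ (a, b) = 1\<^sub>m n $$ (a, b)"
      using F[OF ab, of 0] ab nth_eq_iff_index_eq[OF xs(1)] n by auto
  qed (use Fdim[of 0] in auto)
  moreover have "mat_lincomb n 5 (\<lambda>_. 1) F = mat n n (\<lambda>_. 1)"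
    unfolding lincomb by (rule eq_matI) auto
  moreover have "rels i \<noteq> {}" if "i \<le> 5" for i
  proof -
    obtain x where x: "x \<in> V" using V_nonempty by blast
    have "i < 6" using that by simp
    then have "card {z\<in>V. cls x z = i} > 0"
      using less_6_cases[OF \<open>i < 6\<close>] k_eq unfolding card_cell[OF x \<open>i < 6\<close>]
      by (elim disjE) (simp_all add: Qk_size_def)
    then have "{z\<in>V. cls x z = i} \<noteq> {}" by force
    then show ?thesis using x by (auto simp: rels_def)
  qed
  ultimately show ?thesis
    unfolding sym_assoc_scheme_def n_def[symmetric]
    using xs prod F_def by (auto simp: rels_def intro!: exI[of _ xs] exI[of _ F])
qed

lemma relation_graph: "relation_graph_with_diagram G 5 (Qk_size k) (Qk_quot k)"
  unfolding relation_graph_with_diagram_def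
proof (intro exI conjI)
  show "sym_assoc_scheme 5 V rels" by (rule scheme)
  show "1 \<in> {1..5::nat}" by simp
  show "G = \<lparr>pverts = V, parcs = rels 1\<rparr>" using parcs_eq by simp
  show "id permutes {1..5::nat}" by (rule permutes_id)
  have "{y \<in> V. (x, y) \<in> rels (id j)} = {y\<in>V. cls x y = j}" if "x \<in> V" for x j
    using that by (auto simp: rels_def)
  then show "\<forall>x\<in>V. distribution_diagram G (5 + 1) (\<lambda>j. {y \<in> V. (x, y) \<in> rels (id j)})
      (Qk_size k) (Qk_quot k)"
    using diagram by simp
qed

lemma bipartite: "bipartite G"
  unfolding bipartite_def
proof (intro exI conjI)
  show "{x\<in>V. s x} \<union> {x\<in>V. \<not> s x} = V" "{x\<in>V. s x} \<inter> {x\<in>V. \<not> s x} = {}" by auto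
  show "parcs G \<subseteq> {x\<in>V. s x} \<times> {x\<in>V. \<not> s x} \<union> {x\<in>V. \<not> s x} \<times> {x\<in>V. s x}"
  proof (rule subrelI)
    fix x y assume "(x, y) \<in> parcs G"
    then have "y \<in> N x" by (simp add: nbrs_def)
    then have "x \<in> V" "y \<in> V" "s y \<noteq> s x" using side[of y x] Nsym[of y x] NV by blast+
    then show "(x, y) \<in> {x\<in>V. s x} \<times> {x\<in>V. \<not> s x} \<union> {x\<in>V. \<not> s x} \<times> {x\<in>V. s x}"
      by simp
  qed
qed

lemma Q_regular: "Q_regular G 6 (Qk_size k) (Qk_quot k)"
  unfolding Q_regular_def
proof
  fix x assume x: "x \<in> V"
  show "\<exists>B. distribution_diagram G 6 B (Qk_size k) (Qk_quot k) \<and> B 0 = {x}"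
    using diagram[OF x] cls_cells(1)[OF x] by (intro exI conjI)
qed

lemma order: "card V = 4 * k + 4"
proof -
  have "V = {x\<in>V. s x = True} \<union> {x\<in>V. s x = False}" by auto
  then have "card V = card {x\<in>V. s x = True} + card {x\<in>V. s x = False}"
    by (subst card_Un_disjoint[symmetric]) auto
  then show ?thesis using half[of True] half[of False] by simp
qed

end

section \<open>Walks and eigenvalues\<close>

lemma num_walks_0:
  assumes "pair_graph G" "x \<in> pverts G"
  shows "num_walks G 0 x y = (if x = y then 1 else 0)"
proof -
  interpret pair_graph G by fact
  have "{p. awalk x p y \<and> length p = 0} = (if x = y then {[]} else {})"
    using assms(2) by (auto simp: awalk_Nil_iff)
  then show ?thesis by (simp add: num_walks_def)
qed

lemma num_walks_Suc:
  assumes "pair_graph G"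
  shows "num_walks G (Suc l) x y = (\<Sum>z\<in>nbrs G x. num_walks G l z y)"
proof -
  interpret pair_graph G by fact
  define S where "S l z = {p. awalk z p y \<and> length p = l}" for l z
  have "S l z \<subseteq> {p. set p \<subseteq> parcs G \<and> length p = l}" for l z
    by (auto simp: S_def awalk_def)
  then have fin: "finite (S l z)" for l z
    using finite_lists_length_eq[OF pair_finite_arcs] finite_subset by blast
  have "S (Suc l) x = (\<Union>z\<in>nbrs G x. (#) (x, z) ` S l z)"
  proof (intro equalityI subsetI)
    fix p assume "p \<in> S (Suc l) x"
    then obtain e q where "p = e # q" "awalk x (e # q) y" "length q = l"
      by (cases p) (auto simp: S_def)
    then show "p \<in> (\<Union>z\<in>nbrs G x. (#) (x, z) ` S l z)"
      by (cases e) (auto simp: awalk_Cons_iff S_def nbrs_def)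
  qed (auto simp: awalk_Cons_iff S_def nbrs_def)
  moreover have "card (\<Union>z\<in>nbrs G x. (#) (x, z) ` S l z) = (\<Sum>z\<in>nbrs G x. card ((#) (x, z) ` S l z))"
    using fin finite_nbrs[OF assms] by (intro card_UN_disjoint) auto
  moreover have "card ((#) (x, z) ` S l z) = card (S l z)" for z
    by (rule card_image) simp
  ultimately show ?thesis by (simp add: num_walks_def S_def)
qed

text \<open>The distance is an infimum of walk lengths. Lengths are integers, so an infimum below
  \<open>i + 1\<close> forces a walk that attains it.\<close>

lemma graph_dist_eq_walk:
  assumes "pair_graph G" and d: "graph_dist G x y = ereal (real i)"
  obtains p where "pre_digraph.awalk (with_proj G) x p y" "length p = i"
    "\<And>q. pre_digraph.awalk (with_proj G) x q y \<Longrightarrow> i \<le> length q"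
proof -
  interpret pair_graph G by fact
  have cost: "awalk_cost (\<lambda>_. 1) p = real (length p)" for p :: "('a \<times> 'a) list"
    by (induction p) (auto simp: awalk_cost_def)
  have d': "(INF p\<in>{p. awalk x p y}. ereal (real (length p))) = ereal (real i)"
    using d unfolding graph_dist_def \<mu>_def cost .
  have min: "i \<le> length q" if "awalk x q y" for q
  proof -
    have "(INF p\<in>{p. awalk x p y}. ereal (real (length p))) \<le> ereal (real (length q))"
      using that by (intro INF_lower) simp
    then show ?thesis by (simp add: d')
  qed
  have "(INF p\<in>{p. awalk x p y}. ereal (real (length p))) < ereal (real (Suc i))"
    by (simp add: d')
  then obtain p where "awalk x p y" "length p < Suc i"
    by (auto simp: INF_less_iff)
  with min show thesis by (intro that[of p]) (auto intro: le_antisym)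
qed

context divisible_bipartite begin

text \<open>By induction the powers of \<open>A\<close> stay functions of the class, with
  \<open>step\<close> as the recursion. Here \<open>y\<close> serves as the base vertex, since the
  recursion moves \<open>x\<close>.\<close>

lemma num_walks_cls: "\<exists>c. \<forall>x\<in>V. \<forall>y\<in>V. num_walks G l x y = c (cls x y)"
proof (induction l)
  case 0
  have "num_walks G 0 x y = (if cls x y = 0 then 1 else 0)" if "x \<in> V" "y \<in> V" for x y
  proof -
    have "cls x y = 0 \<longleftrightarrow> y = x"
      using cls_cells(1)[OF that(1)] that(2) by (auto simp: set_eq_iff)
    then show ?thesis using num_walks_0[OF graph that(1)] by simp
  qed
  then show ?case by (intro exI[of _ "\<lambda>i. if i = 0 then 1 else 0"]) blast
next
  case (Suc l)
  then obtain c where c: "\<And>x y. x \<in> V \<Longrightarrow> y \<in> V \<Longrightarrow> num_walks G l x y = c (cls x y)" by blast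
  have "num_walks G (Suc l) x y = step c (cls x y)" if x: "x \<in> V" and y: "y \<in> V" for x y
  proof -
    have "num_walks G (Suc l) x y = (\<Sum>z\<in>N x. c (cls y z))"
      unfolding num_walks_Suc[OF graph] using c y NV[of x] cls_commute[OF y] by (intro sum.cong) auto
    then show ?thesis using sum_nbrs_cls[OF y x, of c] cls_commute[OF x y] by simp
  qed
  then show ?case by blast
qed

text \<open>Up to distance two the class number is the distance, which turns
  \<open>num_walks_cls\<close> into walk-regularity. At distance two the middle vertex is a common
  neighbour, hence \<open>y\<close> is not \<open>\<tau> x\<close>.\<close>

lemma cls_eq_dist:
  assumes x: "x \<in> V" and y: "y \<in> V" and i: "i \<le> 2" and d: "graph_dist G x y = ereal (real i)"
  shows "cls x y = i"
proof -
  interpret pair_graph G by (rule graph)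
  obtain p where p: "awalk x p y" "length p = i" and min: "\<And>q. awalk x q y \<Longrightarrow> i \<le> length q"
    using graph_dist_eq_walk[OF graph d] by blast
  consider "i = 0" | "i = 1" | "i = 2" using i by linarith
  then show ?thesis
  proof cases
    case 1
    then show ?thesis using p cls_cells(1)[OF x] x by (auto simp: awalk_Nil_iff set_eq_iff)
  next
    case 2
    then obtain e where "p = [e]" using p by (auto simp: length_Suc_conv)
    then have "y \<in> N x" using p by (auto simp: awalk_simps nbrs_def)
    then show ?thesis using cls_cells(2)[OF x] 2 by blast
  next
    case 3
    then obtain e1 e2 where "p = [e1, e2]" using p by (auto simp: length_Suc_conv numeral_2_eq_2)
    then obtain z where z: "z \<in> N x" "y \<in> N z" using p
      by (cases e1; cases e2) (auto simp: awalk_simps nbrs_def)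
    have "s y = s x" using side[OF z(1)] side[OF z(2)] by auto
    moreover have "y \<noteq> x" using min[of "[]"] 3 x by (auto simp: awalk_Nil_iff)
    moreover have "y \<noteq> \<tau> x" using z tau_disj[OF x] Nsym[of z y] by blast
    ultimately show ?thesis using 3 by (simp add: cls_def)
  qed
qed

lemma walk_regular:
  assumes "graph_connected G"
  shows "walk_regular 2 G"
  unfolding walk_regular_def
proof (intro conjI allI impI)
  fix l i :: nat assume i: "i \<le> 2"
  obtain c where "\<forall>x\<in>V. \<forall>y\<in>V. num_walks G l x y = c (cls x y)"
    using num_walks_cls by blast
  then show "\<exists>w. \<forall>x\<in>V. \<forall>y\<in>V. graph_dist G x y = ereal (real i) \<longrightarrow> num_walks G l x y = w"
    using cls_eq_dist[OF _ _ i] by (intro exI[of _ "c i"]) metis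
qed (rule assms)

end

text \<open>Functions on \<open>set xs\<close> replace vectors, which makes eigenvalues independent
  of the enumeration.\<close>

lemma eigenvalue_rel_mat_iff:
  assumes "distinct xs"
  shows "eigenvalue (rel_mat xs R) \<theta> \<longleftrightarrow>
    (\<exists>f. (\<exists>x\<in>set xs. f x \<noteq> 0) \<and>
      (\<forall>x\<in>set xs. (\<Sum>y\<in>{y\<in>set xs. (x, y) \<in> R}. f y) = \<theta> * f x))"
    (is "?L \<longleftrightarrow> (\<exists>f. ?P f)")
proof -
  define n where "n = length xs"
  define A :: "'b mat" where "A = rel_mat xs R"
  have A: "A \<in> carrier_mat n n" by (simp add: A_def n_def rel_mat_carrier)
  have key: "eigenvector A (vec n (\<lambda>i. f (xs ! i))) \<theta> \<longleftrightarrow> ?P f" for f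
  proof -
    let ?v = "vec n (\<lambda>i. f (xs ! i))"
    have row: "(A *\<^sub>v ?v) $ a = (\<Sum>y\<in>{y\<in>set xs. (xs ! a, y) \<in> R}. f y)" if "a < n" for a
    proof -
      have "(A *\<^sub>v ?v) $ a = (\<Sum>b<n. A $$ (a, b) * f (xs ! b))"
        using A that by (simp add: scalar_prod_def atLeast0LessThan)
      also have "\<dots> = (\<Sum>b<n. if (xs ! a, xs ! b) \<in> R then f (xs ! b) else 0)"
        using that by (intro sum.cong) (auto simp: A_def n_def index_rel_mat)
      also have "\<dots> = (\<Sum>y\<in>set xs. if (xs ! a, y) \<in> R then f y else 0)"
        using sum_nth_distinct[OF assms, of "\<lambda>y. if (xs ! a, y) \<in> R then f y else 0"]
        by (simp add: n_def)
      finally show ?thesis by (simp add: sum.inter_filter)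
    qed
    have "?v \<noteq> 0\<^sub>v n \<longleftrightarrow> (\<exists>x\<in>set xs. f x \<noteq> 0)"
      by (auto simp: vec_eq_iff n_def set_conv_nth)
    moreover have "A *\<^sub>v ?v = \<theta> \<cdot>\<^sub>v ?v \<longleftrightarrow> (\<forall>a<n. (A *\<^sub>v ?v) $ a = \<theta> * f (xs ! a))"
      using A by (auto simp: vec_eq_iff)
    moreover have "\<dots> \<longleftrightarrow> (\<forall>x\<in>set xs. (\<Sum>y\<in>{y\<in>set xs. (x, y) \<in> R}. f y) = \<theta> * f x)"
      using row by (simp add: all_set_conv_all_nth flip: n_def)
    ultimately show ?thesis using A by (simp add: eigenvector_def)
  qed
  \<comment> \<open>As \<open>xs\<close> is distinct, a vector becomes a function by sending each
    element to the entry at its position.\<close>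
  have "\<exists>f. v = vec n (\<lambda>i. f (xs ! i))" if "v \<in> carrier_vec n" for v :: "'b vec"
  proof (intro exI eq_vecI)
    fix i assume "i < dim_vec (vec n (\<lambda>i. v $ the_inv_into {..<n} ((!) xs) (xs ! i)))"
    then show "v $ i = vec n (\<lambda>i. v $ the_inv_into {..<n} ((!) xs) (xs ! i)) $ i"
      using inj_on_nth[OF assms, of "{..<n}"] by (simp add: the_inv_into_f_f n_def)
  qed (use that in auto)
  then have "eigenvalue A \<theta> \<longleftrightarrow> (\<exists>f. eigenvector A (vec n (\<lambda>i. f (xs ! i))) \<theta>)"
    using A unfolding eigenvalue_def eigenvector_def by (metis carrier_matD(1))
  then show ?thesis unfolding A_def[symmetric] key .
qed

section \<open>The spectrum\<close>

context divisible_bipartite begin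

definition half_sum :: "('a \<Rightarrow> complex) \<Rightarrow> bool \<Rightarrow> complex" where
  "half_sum f b = (\<Sum>z\<in>{z\<in>V. s z = b}. f z)"

definition eigenfunction :: "complex \<Rightarrow> ('a \<Rightarrow> complex) \<Rightarrow> bool" where
  "eigenfunction \<theta> f \<longleftrightarrow> (\<exists>x\<in>V. f x \<noteq> 0) \<and> (\<forall>x\<in>V. (\<Sum>y\<in>N x. f y) = \<theta> * f x)"

lemma graph_eigenvalues_eq: "graph_eigenvalues G = {\<theta>. \<exists>f. eigenfunction \<theta> f}"
proof -
  obtain xs where xs: "distinct xs" "set xs = V"
    using finite_distinct_list[OF finV] by blast
  have "eigenvalue (rel_mat ys (parcs G)) \<theta> \<longleftrightarrow> (\<exists>f. eigenfunction \<theta> f)"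
    if ys: "distinct ys" "set ys = V" for ys \<theta>
  proof -
    have "{y\<in>V. (x, y) \<in> parcs G} = N x" for x
      using NV[of x] by (auto simp: nbrs_def)
    then show ?thesis
      unfolding eigenvalue_rel_mat_iff[OF ys(1)] ys(2) eigenfunction_def by simp
  qed
  then show ?thesis using xs unfolding graph_eigenvalues_def by blast
qed

text \<open>The equation \<open>A\<^sup>2 = (k - m) I - m T + m E\<close> applied to
  \<open>f\<close>, with the entries taken from \<open>common_eq\<close>.\<close>

lemma adj_square:
  assumes x: "x \<in> V"
  shows "(\<Sum>y\<in>N x. \<Sum>z\<in>N y. f z) = (of_nat k - of_nat m) * f x - of_nat m * f (\<tau> x)
    + of_nat m * half_sum f (s x)"
proof -
  let ?H = "{z\<in>V. s z = s x}"
  have "(\<Sum>y\<in>N x. \<Sum>z\<in>N y. f z) = (\<Sum>y\<in>N x. \<Sum>z | z \<in> ?H \<and> z \<in> N y. f z)"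
  proof (rule sum.cong[OF refl])
    fix y assume y: "y \<in> N x"
    have "z \<in> ?H" if "z \<in> N y" for z
      using side[OF y] side[OF that] NV[of y] that by auto
    then have "N y = {z. z \<in> ?H \<and> z \<in> N y}" by blast
    then show "(\<Sum>z\<in>N y. f z) = (\<Sum>z | z \<in> ?H \<and> z \<in> N y. f z)" by (rule sum.cong) simp
  qed
  also have "\<dots> = (\<Sum>z\<in>?H. \<Sum>y | y \<in> N x \<and> z \<in> N y. f z)"
    by (rule sum.swap_restrict) simp_all
  also have "\<dots> = (\<Sum>z\<in>?H. (of_nat m + (if z = x then of_nat k - of_nat m else 0)
      - (if z = \<tau> x then of_nat m else 0)) * f z)"
  proof (rule sum.cong[OF refl])
    fix z assume z: "z \<in> ?H"
    have "{y. y \<in> N x \<and> z \<in> N y} = N x \<inter> N z" by (auto simp: Nsym[where y = z])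
    then have "(\<Sum>y | y \<in> N x \<and> z \<in> N y. f z) = of_int (int (card (N x \<inter> N z))) * f z" by simp
    also have "int (card (N x \<inter> N z)) = int m + (if z = x then int k - int m else 0)
        - (if z = \<tau> x then int m else 0)"
      using z x by (intro common_eq) auto
    finally show "(\<Sum>y | y \<in> N x \<and> z \<in> N y. f z) = (of_nat m +
        (if z = x then of_nat k - of_nat m else 0) - (if z = \<tau> x then of_nat m else 0)) * f z"
      by (cases "z = x"; cases "z = \<tau> x") simp_all
  qed
  also have "\<dots> = (\<Sum>z\<in>?H. of_nat m * f z + (if z = x then (of_nat k - of_nat m) * f x else 0)
      - (if z = \<tau> x then of_nat m * f (\<tau> x) else 0))"
    by (intro sum.cong) (auto simp: algebra_simps)
  also have "\<dots> = of_nat m * half_sum f (s x) + (of_nat k - of_nat m) * f x - of_nat m * f (\<tau> x)"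
    using x tau_in[OF x] tau_side[OF x]
    by (simp add: sum.distrib sum_subtractf half_sum_def sum_distrib_left)
  finally show ?thesis by simp
qed

text \<open>Double counting: every vertex of the other half is counted once from each of its
  \<open>k\<close> neighbours.\<close>

lemma half_sum_adj: "half_sum (\<lambda>x. \<Sum>y\<in>N x. f y) b = of_nat k * half_sum f (\<not> b)"
proof -
  let ?H = "\<lambda>b. {z\<in>V. s z = b}"
  have "half_sum (\<lambda>x. \<Sum>y\<in>N x. f y) b = (\<Sum>x\<in>?H b. \<Sum>y | y \<in> ?H (\<not> b) \<and> y \<in> N x. f y)"
    unfolding half_sum_def
  proof (rule sum.cong[OF refl])
    fix x assume "x \<in> ?H b"
    then have "y \<in> ?H (\<not> b)" if "y \<in> N x" for y using side[OF that] NV[of x] that by auto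
    then have "N x = {y. y \<in> ?H (\<not> b) \<and> y \<in> N x}" by blast
    then show "(\<Sum>y\<in>N x. f y) = (\<Sum>y | y \<in> ?H (\<not> b) \<and> y \<in> N x. f y)" by (rule sum.cong) simp
  qed
  also have "\<dots> = (\<Sum>y\<in>?H (\<not> b). \<Sum>x | x \<in> ?H b \<and> y \<in> N x. f y)"
    by (rule sum.swap_restrict) simp_all
  also have "\<dots> = (\<Sum>y\<in>?H (\<not> b). of_nat k * f y)"
  proof (rule sum.cong[OF refl])
    fix y assume y: "y \<in> ?H (\<not> b)"
    then have "x \<in> ?H b" if "x \<in> N y" for x using side[OF that] NV[of y] that by auto
    then have "{x. x \<in> ?H b \<and> y \<in> N x} = N y" using Nsym[where y = y] by blast
    then show "(\<Sum>x | x \<in> ?H b \<and> y \<in> N x. f y) = of_nat k * f y" using deg y by simp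
  qed
  finally show ?thesis by (simp add: half_sum_def sum_distrib_left)
qed

text \<open>If \<open>f\<close> differs at some \<open>x\<close> and \<open>\<tau> x\<close>,
  subtracting \<open>adj_square\<close> at the two gives \<open>k\<close>. If some half sum is
  nonzero, \<open>half_sum_adj\<close> used twice gives \<open>k\<^sup>2\<close>. Otherwise
  \<open>adj_square\<close> collapses to
  \<open>\<theta>\<^sup>2 f = (k - 2 * m) f = f\<close>.\<close>

lemma eigenfunction_square:
  assumes "eigenfunction \<theta> f"
  shows "\<theta>\<^sup>2 = of_nat k \<or> \<theta>\<^sup>2 = 1 \<or> \<theta>\<^sup>2 = (of_nat k)\<^sup>2"
proof -
  have ev: "(\<Sum>y\<in>N x. f y) = \<theta> * f x" if "x \<in> V" for x
    using assms that by (simp add: eigenfunction_def)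
  have kc: "(of_nat k :: complex) = 2 * of_nat m + 1" using k_eq by simp
  have sq: "\<theta>\<^sup>2 * f x = (of_nat k - of_nat m) * f x - of_nat m * f (\<tau> x)
      + of_nat m * half_sum f (s x)" if x: "x \<in> V" for x
  proof -
    have "(\<Sum>y\<in>N x. \<Sum>z\<in>N y. f z) = (\<Sum>y\<in>N x. \<theta> * f y)"
      using ev NV[of x] by (intro sum.cong) auto
    also have "\<dots> = \<theta>\<^sup>2 * f x"
      using ev[OF x] by (simp add: sum_distrib_left[symmetric] power2_eq_square)
    finally show ?thesis using adj_square[OF x, of f] by simp
  qed
  have "\<theta>\<^sup>2 = of_nat k" if "x \<in> V" "f (\<tau> x) \<noteq> f x" for x
  proof -
    have "\<theta>\<^sup>2 * (f x - f (\<tau> x)) = of_nat k * (f x - f (\<tau> x))"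
      unfolding right_diff_distrib sq[OF that(1)] sq[OF tau_in[OF that(1)]] tau_tau[OF that(1)]
        tau_side[OF that(1)]
      by (simp add: algebra_simps)
    then show ?thesis using that(2) by simp
  qed
  moreover have "\<theta>\<^sup>2 = (of_nat k)\<^sup>2" if "half_sum f b \<noteq> 0" for b
  proof -
    have *: "\<theta> * half_sum f b = of_nat k * half_sum f (\<not> b)" for b
    proof -
      have "\<theta> * half_sum f b = half_sum (\<lambda>x. \<Sum>y\<in>N x. f y) b"
        using ev by (simp add: half_sum_def sum_distrib_left)
      then show ?thesis by (simp add: half_sum_adj)
    qed
    have "\<theta>\<^sup>2 * half_sum f b = of_nat k * (\<theta> * half_sum f (\<not> b))"
      using *[of b] by (simp add: power2_eq_square mult.left_commute mult.assoc)
    also have "\<dots> = (of_nat k)\<^sup>2 * half_sum f b"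
      using *[of "\<not> b"] by (simp add: power2_eq_square mult.assoc)
    finally have "\<theta>\<^sup>2 * half_sum f b = (of_nat k)\<^sup>2 * half_sum f b" .
    then show ?thesis using that by simp
  qed
  moreover have "\<theta>\<^sup>2 = 1" if "\<forall>x\<in>V. f (\<tau> x) = f x" "\<forall>b. half_sum f b = 0"
  proof -
    obtain x where x: "x \<in> V" "f x \<noteq> 0" using assms by (auto simp: eigenfunction_def)
    have "\<theta>\<^sup>2 * f x = f x" using sq[OF x(1)] that x(1) kc by (simp add: algebra_simps)
    then show ?thesis using x(2) by simp
  qed
  ultimately show ?thesis by blast
qed

text \<open>The eigenfunction is \<open>A f + \<theta> f\<close>, for
  \<open>A (A f + \<theta> f) = \<theta> (\<theta> f + A f)\<close>. As \<open>f\<close> lives on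
  the half of \<open>x\<close>, \<open>A f\<close> vanishes at \<open>x\<close> and the value
  \<open>\<theta> * f x\<close> survives.\<close>

lemma eigenfunction_lift:
  assumes x: "x \<in> V" "f x \<noteq> 0" and zero: "\<And>z. s z \<noteq> s x \<Longrightarrow> f z = 0" and \<theta>: "\<theta> \<noteq> 0"
    and sq: "\<And>z. z \<in> V \<Longrightarrow> (\<Sum>y\<in>N z. \<Sum>w\<in>N y. f w) = \<theta>\<^sup>2 * f z"
  shows "\<exists>g. eigenfunction \<theta> g"
  unfolding eigenfunction_def
proof (intro exI conjI)
  have "(\<Sum>y\<in>N x. f y) = 0" using side[where x = x] zero by (intro sum.neutral) blast
  then show "\<exists>z\<in>V. (\<Sum>y\<in>N z. f y) + \<theta> * f z \<noteq> 0" using x \<theta> by (intro bexI[of _ x]) auto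
  show "\<forall>z\<in>V. (\<Sum>y\<in>N z. (\<Sum>w\<in>N y. f w) + \<theta> * f y) = \<theta> * ((\<Sum>y\<in>N z. f y) + \<theta> * f z)"
    using sq by (simp add: sum.distrib sum_distrib_left[symmetric] algebra_simps power2_eq_square)
qed

text \<open>By \<open>eigenfunction_lift\<close> an eigenfunction of \<open>A\<^sup>2\<close>
  supported on one half is enough, and it serves both square roots.\<close>

lemma square_eigenvalue:
  assumes "\<theta>\<^sup>2 = of_nat k \<or> \<theta>\<^sup>2 = 1 \<or> \<theta>\<^sup>2 = (of_nat k)\<^sup>2"
  shows "\<exists>f. eigenfunction \<theta> f"
proof -
  obtain x where x: "x \<in> V" using V_nonempty by blast
  note tx = tau_in[OF x] tau_side[OF x] tau_ne[OF x] tau_tau[OF x]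
  have "k \<noteq> 0" using k_eq by simp
  then have k0: "(of_nat k :: complex) \<noteq> 0" by simp
  have kc: "(of_nat k :: complex) = 2 * of_nat m + 1" using k_eq by simp
  have \<theta>: "\<theta> \<noteq> 0" using assms k0 by auto
  let ?H = "{z\<in>V. s z = s x}"
  have cardH: "(of_nat (card ?H) :: complex) = 2 * of_nat k + 2" using half[of "s x"] by simp
  from assms show ?thesis
  proof (elim disjE)
    assume t: "\<theta>\<^sup>2 = of_nat k"
    \<comment> \<open>Antisymmetric under \<open>\<tau>\<close> with half sums zero, so
      \<open>adj_square\<close> leaves the factor \<open>(k - m) + m = k\<close>.\<close>
    define f :: "'a \<Rightarrow> complex" where "f z = (if z = x then 1 else if z = \<tau> x then - 1 else 0)" for z
    have "f (\<tau> z) = - f z" if "z \<in> V" for z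
      using tx tau_eq_iff[OF that x] tau_eq_iff[OF that tx(1)] by (auto simp: f_def)
    moreover have "half_sum f b = 0" for b
    proof -
      have "half_sum f b = (\<Sum>z\<in>{z\<in>V. s z = b}. (if z = x then 1 else 0) - (if z = \<tau> x then 1 else 0))"
        unfolding half_sum_def using tx by (intro sum.cong) (auto simp: f_def)
      then show ?thesis using x tx by (simp add: sum_subtractf)
    qed
    ultimately have "(\<Sum>y\<in>N z. \<Sum>w\<in>N y. f w) = \<theta>\<^sup>2 * f z" if "z \<in> V" for z
      using that by (simp add: adj_square t algebra_simps)
    moreover have "f z = 0" if "s z \<noteq> s x" for z using that tx by (auto simp: f_def)
    moreover have "f x \<noteq> 0" using k0 by (simp add: f_def)
    ultimately show ?thesis using x \<theta> by (intro eigenfunction_lift[of x f])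
  next
    assume t: "\<theta>\<^sup>2 = 1"
    \<comment> \<open>Invariant under \<open>\<tau>\<close>; the value \<open>k + 1\<close> at two
      vertices balances the \<open>2 * k + 2\<close> ones of the half, so the half sums vanish and
      the factor is \<open>k - 2 * m = 1\<close>.\<close>
    define f :: "'a \<Rightarrow> complex" where
      "f z = (if z = x \<or> z = \<tau> x then of_nat k + 1 else 0) - (if s z = s x then 1 else 0)" for z
    have "f (\<tau> z) = f z" if "z \<in> V" for z
      using tx tau_eq_iff[OF that x] tau_eq_iff[OF that tx(1)] tau_side[OF that]
      by (auto simp: f_def)
    moreover have "half_sum f b = 0" for b
    proof (cases "b = s x")
      case True
      have "half_sum f b = (\<Sum>z\<in>?H. (if z = x then of_nat k + 1 else 0) +
          (if z = \<tau> x then of_nat k + 1 else 0) - 1)"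
        unfolding half_sum_def True using tx by (intro sum.cong) (auto simp: f_def)
      then show ?thesis using x tx cardH by (simp add: sum_subtractf sum.distrib)
    next
      case False
      then show ?thesis unfolding half_sum_def using tx by (intro sum.neutral) (auto simp: f_def)
    qed
    ultimately have "(\<Sum>y\<in>N z. \<Sum>w\<in>N y. f w) = \<theta>\<^sup>2 * f z" if "z \<in> V" for z
      using that by (simp add: adj_square t kc algebra_simps)
    moreover have "f z = 0" if "s z \<noteq> s x" for z using that tx by (auto simp: f_def)
    moreover have "f x \<noteq> 0" using k0 by (simp add: f_def)
    ultimately show ?thesis using x \<theta> by (intro eigenfunction_lift[of x f])
  next
    assume t: "\<theta>\<^sup>2 = (of_nat k)\<^sup>2"
    \<comment> \<open>On the indicator of a half the factor is \<open>(k - 2 * m) + m * (2 * k + 2)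
      = 1 + (k - 1) * (k + 1) = k\<^sup>2\<close>.\<close>
    define f :: "'a \<Rightarrow> complex" where "f z = (if s z = s x then 1 else 0)" for z
    have "f (\<tau> z) = f z" if "z \<in> V" for z
      using tau_side[OF that] by (simp add: f_def)
    moreover have "half_sum f (s z) = (2 * of_nat k + 2) * f z" for z
    proof (cases "s z = s x")
      case True
      then show ?thesis using cardH by (simp add: half_sum_def f_def)
    next
      case False
      then have "half_sum f (s z) = 0"
        unfolding half_sum_def by (intro sum.neutral) (auto simp: f_def)
      then show ?thesis using False by (simp add: f_def)
    qed
    moreover have "\<theta>\<^sup>2 = of_nat k * of_nat k" using t by (rule trans) (rule power2_eq_square)
    ultimately have "(\<Sum>y\<in>N z. \<Sum>w\<in>N y. f w) = \<theta>\<^sup>2 * f z" if "z \<in> V" for z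
      using that by (simp add: adj_square kc algebra_simps)
    moreover have "f z = 0" if "s z \<noteq> s x" for z using that by (auto simp: f_def)
    moreover have "f x \<noteq> 0" using k0 by (simp add: f_def)
    ultimately show ?thesis using x \<theta> by (intro eigenfunction_lift[of x f])
  qed
qed

lemma card_eigenvalues: "card (graph_eigenvalues G) = 6"
proof -
  define r where "r = sqrt (real k)"
  \<comment> \<open>From \<open>k > 1\<close> follows \<open>1 < r < k\<close>, which keeps the six
    values distinct.\<close>
  have r: "1 < r" "r < real k" "r\<^sup>2 = real k"
    using k_eq m_ge2 real_less_lsqrt[of "real k" "real k"] by (auto simp: r_def power2_eq_square)
  have rc: "(complex_of_real r)\<^sup>2 = of_nat k"
    using r(3) by (metis of_real_of_nat_eq of_real_power)
  have "graph_eigenvalues G = complex_of_real ` {r, - r, 1, - 1, real k, - real k}"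
  proof -
    have "(\<exists>f. eigenfunction \<theta> f) \<longleftrightarrow>
        \<theta>\<^sup>2 = (complex_of_real r)\<^sup>2 \<or> \<theta>\<^sup>2 = 1\<^sup>2 \<or> \<theta>\<^sup>2 = (of_nat k)\<^sup>2" for \<theta>
      using eigenfunction_square[of \<theta>] square_eigenvalue[of \<theta>] rc by auto
    then show ?thesis
      unfolding graph_eigenvalues_eq power2_eq_iff by auto
  qed
  moreover have "card {r, - r, 1, - 1, real k, - real k} = 6"
    using r by auto
  moreover have "inj_on complex_of_real {r, - r, 1, - 1, real k, - real k}"
    by (simp add: inj_on_def)
  ultimately show ?thesis by (simp only: card_image)
qed

end

section \<open>Group divisible designs\<close>

text \<open>Since the image has the form \<open>with_proj H\<close>, the tail and head maps of the
  isomorphism are \<open>fst\<close> and \<open>snd\<close>, so its arc map is determined by the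
  vertex map.\<close>

lemma digraph_iso_with_projE:
  assumes "digraph_iso (with_proj G) (with_proj H)"
  obtains h where "inj_on h (pverts G)" "pverts H = h ` pverts G"
    "parcs H = map_prod h h ` parcs G"
proof -
  obtain f where iso: "pre_digraph.digraph_isomorphism (with_proj G) f"
    and H: "with_proj H = app_iso f (with_proj G)"
    using assms by (auto simp: digraph_iso_def)
  have ends: "iso_tail f = fst" "iso_head f = snd"
    using arg_cong[OF H, of tail] arg_cong[OF H, of head] by simp_all
  have "iso_arcs f a = map_prod (iso_verts f) (iso_verts f) a" if "a \<in> parcs G" for a
    using iso that ends by (auto simp: pre_digraph.digraph_isomorphism_def prod_eq_iff)
  then have "parcs H = map_prod (iso_verts f) (iso_verts f) ` parcs G"
    using arg_cong[OF H, of arcs] by simp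
  moreover have "inj_on (iso_verts f) (pverts G)"
    using iso by (simp add: pre_digraph.digraph_isomorphism_def)
  moreover have "pverts H = iso_verts f ` pverts G"
    using arg_cong[OF H, of verts] by simp
  ultimately show thesis using that by blast
qed

lemma digraph_iso_with_projI:
  assumes G: "pair_wf_digraph G" and inj: "inj_on h (pverts G)"
    and "pverts H = h ` pverts G" "parcs H = map_prod h h ` parcs G"
  shows "digraph_iso (with_proj G) (with_proj H)"
  unfolding digraph_iso_def
proof (intro exI conjI)
  let ?f = "\<lparr>iso_verts = h, iso_arcs = map_prod h h, iso_head = snd, iso_tail = fst\<rparr>"
  interpret pair_wf_digraph G by fact
  have "parcs G \<subseteq> pverts G \<times> pverts G" by (auto dest: in_arcsD1 in_arcsD2)
  then have "inj_on (map_prod h h) (parcs G)"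
    using map_prod_inj_on[OF inj inj] inj_on_subset by blast
  then show "pre_digraph.digraph_isomorphism (with_proj G) ?f"
    using inj wf_digraph_wp_iff[of G] G by (simp add: pre_digraph.digraph_isomorphism_def)
  show "with_proj H = app_iso ?f (with_proj G)"
    using assms(3,4) by (simp add: app_iso_def with_proj_def)
qed

section \<open>Counting and partners in group divisible designs\<close>

lemma card_uniform_partition:
  assumes "finite X" "partition_on X C" "\<And>c. c \<in> C \<Longrightarrow> card c = n"
  shows "card X = n * card C"
proof -
  have "finite C" using assms(1,2) finite_elements by blast
  then have "n * card C = card (\<Union>C)"
    using assms partition_onD1[OF assms(2)] partition_onD2[OF assms(2)]
    by (intro card_partition) (auto simp: disjoint_def)
  then show ?thesis using partition_onD1[OF assms(2)] by simp
qed

lemma gdd_card_points: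
  assumes "gdd \<P> \<G> \<B> pts n m k l1 l2"
  shows "card \<P> = n * m"
  using assms card_uniform_partition[of \<P> \<G> n] by (auto simp: gdd_def)

text \<open>The partner is the other element of the group of \<open>p\<close>; all remaining points
  lie in other groups.\<close>

lemma gdd_partner:
  assumes gdd: "gdd \<P> \<G> \<B> pts 2 n k 0 m" and p: "p \<in> \<P>"
  shows "\<exists>p'\<in>\<P>. p' \<noteq> p \<and> {b\<in>\<B>. p \<in> pts b \<and> p' \<in> pts b} = {} \<and>
    (\<forall>q\<in>\<P>. q \<noteq> p \<longrightarrow> q \<noteq> p' \<longrightarrow> card {b\<in>\<B>. p \<in> pts b \<and> q \<in> pts b} = m)"
proof -
  have part: "partition_on \<P> \<G>" and fin: "finite \<B>"
    and sz: "\<And>g. g \<in> \<G> \<Longrightarrow> card g = 2"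
    and l1: "\<And>g p q. g \<in> \<G> \<Longrightarrow> p \<in> g \<Longrightarrow> q \<in> g \<Longrightarrow> p \<noteq> q \<Longrightarrow> card {b\<in>\<B>. p \<in> pts b \<and> q \<in> pts b} = 0"
    and l2: "\<And>g h p q. g \<in> \<G> \<Longrightarrow> h \<in> \<G> \<Longrightarrow> g \<noteq> h \<Longrightarrow> p \<in> g \<Longrightarrow> q \<in> h
      \<Longrightarrow> card {b\<in>\<B>. p \<in> pts b \<and> q \<in> pts b} = m"
    using gdd by (simp_all add: gdd_def)
  obtain g where g: "g \<in> \<G>" "p \<in> g" using p partition_onD1[OF part] by blast
  obtain p' where p': "g = {p, p'}" "p' \<noteq> p"
    using sz[OF g(1)] g(2) by (auto simp: card_2_iff)
  have "card {b\<in>\<B>. p \<in> pts b \<and> q \<in> pts b} = m" if q: "q \<in> \<P>" "q \<noteq> p" "q \<noteq> p'" for q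
  proof -
    obtain h where h: "h \<in> \<G>" "q \<in> h" using q(1) partition_onD1[OF part] by blast
    then have "g \<noteq> h" using q p' by blast
    then show ?thesis using l2 g h by blast
  qed
  moreover have "{b\<in>\<B>. p \<in> pts b \<and> p' \<in> pts b} = {}"
    using l1[OF g(1), of p p'] p' fin by simp
  moreover have "p' \<in> \<P>" using p' g partition_onD1[OF part] by blast
  ultimately show ?thesis using p'(2) by blast
qed

text \<open>Partners may be chosen independently for each vertex, as the locale asks for no
  compatibility between the choices.\<close>

lemma ex_divisible_bipartite:
  assumes "pair_graph G" "k = 2 * m + 1" "m \<ge> 2"
    and "\<And>x y. y \<in> nbrs G x \<Longrightarrow> s y \<noteq> s x"
    and "\<And>b. card {y \<in> pverts G. s y = b} = 2 * k + 2"
    and "\<And>x. x \<in> pverts G \<Longrightarrow> card (nbrs G x) = k"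
    and ex: "\<And>x. x \<in> pverts G \<Longrightarrow> \<exists>x'\<in>pverts G. s x' = s x \<and> x' \<noteq> x \<and>
      nbrs G x \<inter> nbrs G x' = {} \<and> (\<forall>y\<in>pverts G. s y = s x \<longrightarrow> y \<noteq> x \<longrightarrow> y \<noteq> x' \<longrightarrow>
        card (nbrs G x \<inter> nbrs G y) = m)"
  shows "\<exists>\<tau>. divisible_bipartite G s \<tau> k m"
proof -
  obtain \<tau> where "\<forall>x\<in>pverts G. \<tau> x \<in> pverts G \<and> s (\<tau> x) = s x \<and> \<tau> x \<noteq> x \<and>
      nbrs G x \<inter> nbrs G (\<tau> x) = {} \<and> (\<forall>y\<in>pverts G. s y = s x \<longrightarrow> y \<noteq> x \<longrightarrow> y \<noteq> \<tau> x \<longrightarrow>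
        card (nbrs G x \<inter> nbrs G y) = m)"
    using ex bchoice[of "pverts G"] by (metis (no_types, lifting))
  then have "divisible_bipartite G s \<tau> k m"
    using assms(1-6) by (intro divisible_bipartite.intro) (assumption | blast)+
  then show ?thesis by blast
qed

lemma nbrs_incidence_graph:
  assumes "\<And>b. b \<in> \<B> \<Longrightarrow> pts b \<subseteq> \<P>"
  shows "p \<in> \<P> \<Longrightarrow> nbrs (incidence_graph \<P> \<B> pts) (Inl p) = Inr ` {b\<in>\<B>. p \<in> pts b}"
    and "b \<in> \<B> \<Longrightarrow> nbrs (incidence_graph \<P> \<B> pts) (Inr b) = Inl ` pts b"
  using assms by (auto simp: nbrs_def incidence_graph_def)

text \<open>The conditions are checked in the incidence graph \<open>H\<close>, with
  \<open>isl\<close> as colour, and pulled back along \<open>h\<close>. Partners of points come from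
  the design, those of blocks from its dual.\<close>

lemma incidence_graph_imp_divisible_bipartite:
  fixes G :: "'a pair_pre_digraph"
  assumes G: "pair_graph G" and k: "k = 2 * m + 1" "m \<ge> 2"
    and inc: "incidence_graph_of_gdddp G 2 (k + 1) k 0 m"
  shows "\<exists>s \<tau>. divisible_bipartite G s \<tau> k m"
proof -
  obtain \<P> \<B> :: "'a set" and \<G> \<G>' :: "'a set set" and pts where
    iso: "digraph_iso (with_proj G) (with_proj (incidence_graph \<P> \<B> pts))"
    and D: "gdd \<P> \<G> \<B> pts 2 (k + 1) k 0 m"
    and D': "gdd \<B> \<G>' \<P> (\<lambda>p. {b\<in>\<B>. p \<in> pts b}) 2 (k + 1) k 0 m"
    using inc unfolding incidence_graph_of_gdddp_def gdddp_def by blast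
  define H where "H = incidence_graph \<P> \<B> pts"
  obtain h where h: "inj_on h (pverts G)" "pverts H = h ` pverts G" "parcs H = map_prod h h ` parcs G"
    using digraph_iso_with_projE[OF iso] H_def by metis
  have Hv: "pverts H = \<P> <+> \<B>" by (simp add: H_def incidence_graph_def)
  have pts: "\<And>b. b \<in> \<B> \<Longrightarrow> pts b \<subseteq> \<P> \<and> card (pts b) = k"
    and dual: "\<And>p. p \<in> \<P> \<Longrightarrow> card {b\<in>\<B>. p \<in> pts b} = k"
    using D D' by (auto simp: gdd_def)
  have nb: "\<And>p. p \<in> \<P> \<Longrightarrow> nbrs H (Inl p) = Inr ` {b\<in>\<B>. p \<in> pts b}"
    "\<And>b. b \<in> \<B> \<Longrightarrow> nbrs H (Inr b) = Inl ` pts b"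
    using nbrs_incidence_graph[of \<B> pts \<P>] pts unfolding H_def by simp_all
  \<comment> \<open>Arcs of \<open>H\<close> are images of arcs of \<open>G\<close>; injectivity of
    \<open>h\<close> on the vertices identifies the tail of such an arc with
    \<open>x\<close>.\<close>
  have nh: "nbrs H (h x) = h ` nbrs G x" if x: "x \<in> pverts G" for x
  proof -
    have "a = x" if "h a = h x" "(a, b) \<in> parcs G" for a b
    proof -
      have "a \<in> nbrs G b" using nbrs_sym[OF G, of b a] that(2) by (simp add: nbrs_def)
      then have "a \<in> pverts G" using nbrs_subset[OF G] by blast
      then show ?thesis using inj_onD[OF h(1) that(1)] x by blast
    qed
    then show ?thesis unfolding nbrs_def h(3) by force
  qed
  have hin: "h x \<in> pverts H" if "x \<in> pverts G" for x using that h(2) by blast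
  have cards: "card (nbrs G x \<inter> nbrs G y) = card (nbrs H (h x) \<inter> nbrs H (h y))"
    if "x \<in> pverts G" "y \<in> pverts G" for x y
  proof -
    have "nbrs H (h x) \<inter> nbrs H (h y) = h ` (nbrs G x \<inter> nbrs G y)"
      unfolding nh[OF that(1)] nh[OF that(2)]
      using h(1) nbrs_subset[OF G] by (intro inj_on_image_Int[symmetric])
    moreover have "inj_on h (nbrs G x \<inter> nbrs G y)"
      using h(1) nbrs_subset[OF G, of x] by (meson inj_on_subset le_infI1)
    ultimately show ?thesis by (simp add: card_image)
  qed
  have degH: "card (nbrs H u) = k" if "u \<in> pverts H" for u
    using that pts dual unfolding Hv by (auto simp: nb card_image)
  have sideH: "isl v \<noteq> isl u" if "v \<in> nbrs H u" for u v
    using that by (auto simp: H_def nbrs_def incidence_graph_def)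
  have halfH: "card {u\<in>pverts H. isl u = b} = 2 * k + 2" for b
  proof (cases b)
    case True
    then have "{u\<in>pverts H. isl u = b} = Inl ` \<P>" by (auto simp: Hv)
    then show ?thesis using gdd_card_points[OF D] by (simp add: card_image)
  next
    case False
    then have "{u\<in>pverts H. isl u = b} = Inr ` \<B>" by (auto simp: Hv)
    then show ?thesis using gdd_card_points[OF D'] by (simp add: card_image)
  qed
  have partnerH: "\<exists>u'\<in>pverts H. isl u' = isl u \<and> u' \<noteq> u \<and> nbrs H u \<inter> nbrs H u' = {} \<and>
      (\<forall>v\<in>pverts H. isl v = isl u \<longrightarrow> v \<noteq> u \<longrightarrow> v \<noteq> u' \<longrightarrow> card (nbrs H u \<inter> nbrs H v) = m)"
    if u: "u \<in> pverts H" for u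
  proof (cases u)
    case (Inl p)
    then have p: "p \<in> \<P>" using u Hv by auto
    have *: "nbrs H (Inl p) \<inter> nbrs H (Inl q) = Inr ` {b\<in>\<B>. p \<in> pts b \<and> q \<in> pts b}"
      if "q \<in> \<P>" for q
      unfolding nb(1)[OF p] nb(1)[OF that] by auto
    obtain p' where "p' \<in> \<P>" "p' \<noteq> p" "{b\<in>\<B>. p \<in> pts b \<and> p' \<in> pts b} = {}"
      "\<forall>q\<in>\<P>. q \<noteq> p \<longrightarrow> q \<noteq> p' \<longrightarrow> card {b\<in>\<B>. p \<in> pts b \<and> q \<in> pts b} = m"
      using gdd_partner[OF D p] by blast
    then show ?thesis
      unfolding Inl by (intro bexI[of _ "Inl p'"]) (auto simp: Hv * card_image)
  next
    case (Inr c)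
    then have c: "c \<in> \<B>" using u Hv by auto
    define T where "T d = {p\<in>\<P>. c \<in> {b\<in>\<B>. p \<in> pts b} \<and> d \<in> {b\<in>\<B>. p \<in> pts b}}" for d
    have *: "nbrs H (Inr c) \<inter> nbrs H (Inr d) = Inl ` T d" if "d \<in> \<B>" for d
      unfolding nb(2)[OF c] nb(2)[OF that] T_def using pts[OF c] pts[OF that] c that by auto
    obtain c' where "c' \<in> \<B>" "c' \<noteq> c" "T c' = {}"
      "\<forall>d\<in>\<B>. d \<noteq> c \<longrightarrow> d \<noteq> c' \<longrightarrow> card (T d) = m"
      using gdd_partner[OF D' c] unfolding T_def by blast
    then show ?thesis
      unfolding Inr by (intro bexI[of _ "Inr c'"]) (auto simp: Hv * card_image)
  qed
  have "\<exists>\<tau>. divisible_bipartite G (\<lambda>x. isl (h x)) \<tau> k m"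
  proof (rule ex_divisible_bipartite[OF G k])
    fix x y assume y: "y \<in> nbrs G x"
    then have "x \<in> pverts G" using nbrs_sym[OF G] nbrs_subset[OF G] by blast
    then show "isl (h y) \<noteq> isl (h x)" using sideH[of "h y" "h x"] nh y by blast
  next
    fix b
    have "{u\<in>pverts H. isl u = b} = h ` {y \<in> pverts G. isl (h y) = b}" using h(2) by auto
    moreover have "inj_on h {y \<in> pverts G. isl (h y) = b}" using h(1) by (rule inj_on_subset) auto
    ultimately show "card {y \<in> pverts G. isl (h y) = b} = 2 * k + 2"
      using halfH[of b] by (simp add: card_image)
  next
    fix x assume x: "x \<in> pverts G"
    show "card (nbrs G x) = k" using cards[OF x x] degH[OF hin[OF x]] by simp
    obtain u' where u': "u' \<in> pverts H" "isl u' = isl (h x)" "u' \<noteq> h x"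
      "nbrs H (h x) \<inter> nbrs H u' = {}"
      "\<And>v. v \<in> pverts H \<Longrightarrow> isl v = isl (h x) \<Longrightarrow> v \<noteq> h x \<Longrightarrow> v \<noteq> u'
        \<Longrightarrow> card (nbrs H (h x) \<inter> nbrs H v) = m"
      using partnerH[OF hin[OF x]] by blast
    obtain x' where x': "x' \<in> pverts G" "u' = h x'" using u'(1) h(2) by blast
    have "nbrs G x \<inter> nbrs G x' = {}"
      using cards[OF x x'(1)] u'(4) x'(2) finite_nbrs[OF G, of x] by simp
    moreover have "card (nbrs G x \<inter> nbrs G y) = m"
      if "y \<in> pverts G" "isl (h y) = isl (h x)" "y \<noteq> x" "y \<noteq> x'" for y
      using cards[OF x that(1)] u'(5)[OF hin[OF that(1)] that(2)] x' x that(1,3,4)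
        inj_onD[OF h(1)] by metis
    ultimately show "\<exists>x'\<in>pverts G. isl (h x') = isl (h x) \<and> x' \<noteq> x \<and>
      nbrs G x \<inter> nbrs G x' = {} \<and> (\<forall>y\<in>pverts G. isl (h y) = isl (h x) \<longrightarrow> y \<noteq> x \<longrightarrow> y \<noteq> x' \<longrightarrow>
        card (nbrs G x \<inter> nbrs G y) = m)"
      using x' u' by (intro bexI[of _ x']) auto
  qed
  then show ?thesis by blast
qed

section \<open>The design carried by the two halves\<close>

context divisible_bipartite begin

text \<open>Groups are the antipodal pairs, and the blocks through two points are their common
  neighbours. \<open>pts\<close> is fixed only on the other half, so that the design and its dual,
  which describe blocks by different terms, are both instances.\<close>

lemma gdd_half:
  assumes pts: "\<And>y. y \<in> V \<Longrightarrow> s y = (\<not> b) \<Longrightarrow> pts y = N y"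
  shows "gdd {x\<in>V. s x = b} ((\<lambda>x. {x, \<tau> x}) ` {x\<in>V. s x = b}) {y\<in>V. s y = (\<not> b)} pts 2 (k + 1) k 0 m"
proof -
  let ?H = "{x\<in>V. s x = b}" and ?K = "{y\<in>V. s y = (\<not> b)}"
  let ?C = "(\<lambda>x. {x, \<tau> x}) ` ?H"
  have tau_H: "\<tau> x \<in> ?H" if "x \<in> ?H" for x using that tau_in tau_side by auto
  \<comment> \<open>A group is the antipodal pair of any of its members. This gives disjointness and
    shows that two points are antipodal exactly if they share a group.\<close>
  have group_eq: "{p, \<tau> p} = {x, \<tau> x}" if "x \<in> ?H" "p \<in> {x, \<tau> x}" for x p
    using that tau_tau[of x] by auto
  have part: "partition_on ?H ?C"
  proof (rule partition_onI)
    show "\<Union> ?C = ?H" using tau_H by auto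
    show "{} \<notin> ?C" by auto
    show "disjnt g h" if "g \<in> ?C" "h \<in> ?C" "g \<noteq> h" for g h
      using that group_eq unfolding disjnt_def by blast
  qed
  have two: "card g = 2" if "g \<in> ?C" for g
    using that tau_ne by (auto simp: card_2_iff)
  have cardC: "card ?C = k + 1"
    using card_uniform_partition[OF _ part two] half[of b] by simp
  have blocks: "{y\<in>?K. p \<in> pts y \<and> q \<in> pts y} = N p \<inter> N q" if "p \<in> ?H" "q \<in> ?H" for p q
  proof -
    have "y \<in> ?K" if "y \<in> N p" for y using side[OF that] NV[of p] that \<open>p \<in> ?H\<close> by auto
    then show ?thesis
      using Nsym[of p] Nsym[of q] pts by blast
  qed
  have pts_H: "pts y \<subseteq> ?H \<and> card (pts y) = k" if "y \<in> ?K" for y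
    using that pts[of y] deg[of y] side[where x = y] NV[of y] by auto
  have l1: "card {y\<in>?K. p \<in> pts y \<and> q \<in> pts y} = 0"
    if as: "g \<in> ?C" "p \<in> g" "q \<in> g" "p \<noteq> q" for g p q
  proof -
    have pq: "p \<in> ?H" "q \<in> ?H" using as partition_onD1[OF part] by blast+
    obtain x where "x \<in> ?H" "g = {x, \<tau> x}" using as(1) by blast
    then have "{p, \<tau> p} = g" using group_eq[of x p] as(2) by simp
    then have "q = \<tau> p" using as(3,4) by blast
    then have "N p \<inter> N q = {}" using tau_disj pq by blast
    then show ?thesis unfolding blocks[OF pq] by simp
  qed
  have l2: "card {y\<in>?K. p \<in> pts y \<and> q \<in> pts y} = m"
    if as: "g \<in> ?C" "h \<in> ?C" "g \<noteq> h" "p \<in> g" "q \<in> h" for g h p q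
  proof -
    have pq: "p \<in> ?H" "q \<in> ?H" using as partition_onD1[OF part] by blast+
    obtain x where "x \<in> ?H" "g = {x, \<tau> x}" using as(1) by blast
    then have g: "g = {p, \<tau> p}" using group_eq[of x p] as(4) by simp
    obtain y where "y \<in> ?H" "h = {y, \<tau> y}" using as(2) by blast
    then have h: "h = {q, \<tau> q}" using group_eq[of y q] as(5) by simp
    have "q \<noteq> p" "q \<noteq> \<tau> p" using as(3) g h tau_tau[of p] pq(1) by auto
    then show ?thesis unfolding blocks[OF pq] using pq by (intro common) auto
  qed
  show ?thesis
    unfolding gdd_def using part cardC two pts_H l1 l2 finV by (intro conjI ballI impI) auto
qed

lemma incidence_graph: "incidence_graph_of_gdddp G 2 (k + 1) k 0 m"
proof -
  let ?P = "{x\<in>V. s x = True}" and ?B = "{x\<in>V. s x = False}"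
  let ?h = "\<lambda>x. if s x then Inl x else Inr x"
  interpret pair_graph G by (rule graph)
  have "gdd ?P ((\<lambda>x. {x, \<tau> x}) ` ?P) ?B N 2 (k + 1) k 0 m"
    using gdd_half[of True N] by simp
  moreover have "gdd ?B ((\<lambda>x. {x, \<tau> x}) ` ?B) ?P (\<lambda>p. {b\<in>?B. p \<in> N b}) 2 (k + 1) k 0 m"
  proof -
    have "{b\<in>?B. p \<in> N b} = N p" if "p \<in> V" "s p" for p
    proof -
      have "b \<in> ?B" if "b \<in> N p" for b using side[OF that] NV[of p] that \<open>s p\<close> by auto
      then show ?thesis using Nsym[of p] by blast
    qed
    then show ?thesis using gdd_half[of False "\<lambda>p. {b\<in>?B. p \<in> N b}"] by simp
  qed
  moreover have "digraph_iso (with_proj G) (with_proj (incidence_graph ?P ?B N))"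
  proof (rule digraph_iso_with_projI)
    show "pair_wf_digraph G" ..
    show "inj_on ?h V" by (auto simp: inj_on_def split: if_splits)
    show "pverts (incidence_graph ?P ?B N) = ?h ` V"
      by (auto simp: incidence_graph_def image_iff split: if_splits)
    have arc: "(x, y) \<in> parcs G \<longleftrightarrow> y \<in> N x" for x y by (simp add: nbrs_def)
    show "parcs (incidence_graph ?P ?B N) = map_prod ?h ?h ` parcs G"
    proof (intro equalityI subrelI)
      fix u w assume "(u, w) \<in> parcs (incidence_graph ?P ?B N)"
      then obtain p b where "p \<in> ?P" "b \<in> ?B" "p \<in> N b"
        and "u = Inl p \<and> w = Inr b \<or> u = Inr b \<and> w = Inl p"
        by (auto simp: incidence_graph_def)
      moreover from this have "(p, b) \<in> parcs G" "(b, p) \<in> parcs G"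
        using Nsym[of p b] arc by auto
      ultimately show "(u, w) \<in> map_prod ?h ?h ` parcs G"
        by (elim disjE) (auto intro: rev_image_eqI)
    next
      fix u w assume "(u, w) \<in> map_prod ?h ?h ` parcs G"
      then obtain x y where xy: "(x, y) \<in> parcs G" "u = ?h x" "w = ?h y" by auto
      have y: "y \<in> N x" and x: "x \<in> N y" using xy(1) arc Nsym[of y x] by auto
      have "x \<in> V" "y \<in> V" using x y NV by auto
      then show "(u, w) \<in> parcs (incidence_graph ?P ?B N)"
        using x y side[OF y] xy(2,3) by (cases "s x") (auto simp: incidence_graph_def)
    qed
  qed
  ultimately show ?thesis
    unfolding incidence_graph_of_gdddp_def gdddp_def by blast
qed

end

section \<open>The distribution diagram\<close>

text \<open>Edges of the diagram join even to odd cells, so the parity of the cell is a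
  two-colouring.\<close>

lemma Qk_quot_parity:
  assumes "i < 6" "j < 6" "Qk_quot k i j \<noteq> 0"
  shows "even i \<noteq> even j"
proof -
  have "i \<in> {0, 1, 2, 3, 4, 5}" "j \<in> {0, 1, 2, 3, 4, 5}" using assms(1,2) by auto
  then show ?thesis using assms(3) by (auto simp: Qk_quot_def)
qed

lemma equitable_partitionD:
  assumes "equitable_partition G n B q"
  shows "(\<Union>i<n. B i) = pverts G"
    and "i < n \<Longrightarrow> j < n \<Longrightarrow> x \<in> B i \<Longrightarrow> x \<in> B j \<Longrightarrow> i = j"
    and "i < n \<Longrightarrow> j < n \<Longrightarrow> x \<in> B i \<Longrightarrow> card (nbrs G x \<inter> B j) = q i j"
proof -
  have p: "partition_on (pverts G) (B ` {..<n})" and inj: "inj_on B {..<n}"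
    and q: "\<forall>i<n. \<forall>j<n. \<forall>x\<in>B i. card (nbrs G x \<inter> B j) = q i j"
    using assms by (simp_all add: equitable_partition_def)
  show "(\<Union>i<n. B i) = pverts G" using partition_onD1[OF p] by simp
  show "i = j" if "i < n" "j < n" "x \<in> B i" "x \<in> B j"
  proof -
    have "B i = B j" using partition_onD2[OF p] that unfolding disjoint_def by blast
    then show ?thesis using inj_onD[OF inj] that by simp
  qed
  show "card (nbrs G x \<inter> B j) = q i j" if "i < n" "j < n" "x \<in> B i"
    using q that by blast
qed

text \<open>A single diagram suffices, with the even and the odd cells as colour classes. This
  supplies the bipartiteness that \<open>relation_graph_with_diagram\<close> does not state.\<close>

lemma Q_regular_imp_bipartite:
  assumes G: "pair_graph G" and Q: "Q_regular G 6 s (Qk_quot k)"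
  shows "bipartite G"
proof (cases "pverts G = {}")
  case True
  then have "nbrs G x = {}" for x using nbrs_subset[OF G] by blast
  then have "parcs G = {}" by (auto simp: nbrs_def)
  then show ?thesis using True by (auto simp: bipartite_def)
next
  case False
  then obtain B where "equitable_partition G 6 B (Qk_quot k)"
    using Q unfolding Q_regular_def distribution_diagram_def by blast
  note B = equitable_partitionD[OF this]
  define U where "U b = (\<Union>i\<in>{i. i < 6 \<and> even i = b}. B i)" for b
  have "parcs G \<subseteq> U True \<times> U False \<union> U False \<times> U True"
  proof (rule subrelI)
    fix x y assume "(x, y) \<in> parcs G"
    then have y: "y \<in> nbrs G x" by (simp add: nbrs_def)
    then have "x \<in> pverts G" "y \<in> pverts G" using nbrs_sym[OF G] nbrs_subset[OF G] by blast+
    then obtain i j where ij: "i < 6" "x \<in> B i" "j < 6" "y \<in> B j" using B(1) by blast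
    have "nbrs G x \<inter> B j \<noteq> {}" using y ij by blast
    then have "Qk_quot k i j \<noteq> 0"
      using B(3)[OF ij(1,3,2)] finite_nbrs[OF G, of x] by auto
    then have "even i \<noteq> even j" using Qk_quot_parity ij by blast
    then show "(x, y) \<in> U True \<times> U False \<union> U False \<times> U True" using ij by (auto simp: U_def)
  qed
  moreover have "U True \<union> U False = pverts G" unfolding B(1)[symmetric] by (auto simp: U_def)
  moreover have "U True \<inter> U False = {}" using B(2) by (force simp: U_def)
  ultimately show ?thesis unfolding bipartite_def by blast
qed

text \<open>In the diagram around \<open>x\<close>, the antipode is the vertex of cell 4. Cells 1
  and 3 are the neighbourhoods of \<open>x\<close> and of the antipode, and any other vertex of the
  half lies in cell 2 and has \<open>m\<close> neighbours in cell 1.\<close>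

lemma Q_regular_imp_divisible_bipartite:
  assumes G: "pair_graph G" and k: "k = 2 * m + 1" "m \<ge> 2" and ne: "pverts G \<noteq> {}"
    and bip: "bipartite G" and Q: "Q_regular G 6 (Qk_size k) (Qk_quot k)"
  shows "\<exists>s \<tau>. divisible_bipartite G s \<tau> k m"
proof -
  obtain U W where UW: "U \<union> W = pverts G" "U \<inter> W = {}" "parcs G \<subseteq> U \<times> W \<union> W \<times> U"
    using bip unfolding bipartite_def by blast
  define s where "s x = (x \<in> U)" for x
  have side: "s y \<noteq> s x" if "y \<in> nbrs G x" for x y
    using that UW(2,3) unfolding nbrs_def s_def by blast
  have cells: "\<exists>B. (\<Union>i<6. B i) = pverts G \<and> B 0 = {x} \<and> (\<forall>i<6. card (B i) = Qk_size k i) \<and>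
      (\<forall>i<6. \<forall>j<6. \<forall>y. y \<in> B i \<longrightarrow> y \<in> B j \<longrightarrow> i = j) \<and>
      (\<forall>i<6. \<forall>j<6. \<forall>y\<in>B i. card (nbrs G y \<inter> B j) = Qk_quot k i j) \<and>
      (\<forall>i<6. \<forall>y\<in>B i. s y = s x \<longleftrightarrow> even i)" if x: "x \<in> pverts G" for x
  proof -
    obtain B where B0: "B 0 = {x}" and sz: "\<forall>i<6. card (B i) = Qk_size k i"
      and eq: "equitable_partition G 6 B (Qk_quot k)"
      using Q x unfolding Q_regular_def distribution_diagram_def by blast
    note B = equitable_partitionD[OF eq]
    \<comment> \<open>The colour passes from cell \<open>j\<close> to cell \<open>i\<close>, as each
      vertex of \<open>B i\<close> has a neighbour in \<open>B j\<close>. Starting at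
      \<open>B 0 = {x}\<close> this reaches every cell.\<close>
    have propagate: "s y = s x \<longleftrightarrow> even i"
      if "y \<in> B i" "i < 6" "j < 6" "Qk_quot k i j \<noteq> 0" "\<And>z. z \<in> B j \<Longrightarrow> s z = s x \<longleftrightarrow> even j" for y i j
    proof -
      have "nbrs G y \<inter> B j \<noteq> {}" using B(3)[OF that(2,3,1)] that(4) by auto
      then obtain z where z: "z \<in> nbrs G y" "z \<in> B j" by blast
      then show ?thesis using side[OF z(1)] that(5)[OF z(2)] Qk_quot_parity[OF that(2-4)] by auto
    qed
    have 0: "s y = s x \<longleftrightarrow> even (0::nat)" if "y \<in> B 0" for y using that B0 by simp
    have 1: "s y = s x \<longleftrightarrow> even (1::nat)" if "y \<in> B 1" for y
      by (rule propagate[of y 1 0]) (use that 0 k in \<open>simp_all add: Qk_quot_def\<close>)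
    have 2: "s y = s x \<longleftrightarrow> even (2::nat)" if "y \<in> B 2" for y
      by (rule propagate[of y 2 1]) (use that 1 k in \<open>simp_all add: Qk_quot_def\<close>)
    have 3: "s y = s x \<longleftrightarrow> even (3::nat)" if "y \<in> B 3" for y
      by (rule propagate[of y 3 2]) (use that 2 k in \<open>simp_all add: Qk_quot_def\<close>)
    have 4: "s y = s x \<longleftrightarrow> even (4::nat)" if "y \<in> B 4" for y
      by (rule propagate[of y 4 3]) (use that 3 k in \<open>simp_all add: Qk_quot_def\<close>)
    have 5: "s y = s x \<longleftrightarrow> even (5::nat)" if "y \<in> B 5" for y
      by (rule propagate[of y 5 2]) (use that 2 k in \<open>simp_all add: Qk_quot_def\<close>)
    have "s y = s x \<longleftrightarrow> even i" if "i < 6" "y \<in> B i" for i y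
    proof -
      have "i = 0 \<or> i = 1 \<or> i = 2 \<or> i = 3 \<or> i = 4 \<or> i = 5" using that(1) by auto
      then show ?thesis
        using that(2) 0[of y] 1[of y] 2[of y] 3[of y] 4[of y] 5[of y] by (elim disjE) simp_all
    qed
    then show ?thesis using B B0 sz by (intro exI[of _ B]) blast
  qed
  have "\<exists>\<tau>. divisible_bipartite G s \<tau> k m"
  proof (rule ex_divisible_bipartite[OF G k side])
    fix b
    obtain x where x: "x \<in> pverts G" using ne by blast
    obtain B where un: "(\<Union>i<6. B i) = pverts G" and sz [rule_format]: "\<forall>i<6. card (B i) = Qk_size k i"
      and dj [rule_format]: "\<forall>i<6. \<forall>j<6. \<forall>y. y \<in> B i \<longrightarrow> y \<in> B j \<longrightarrow> i = j"
      and sd [rule_format]: "\<forall>i<6. \<forall>y\<in>B i. s y = s x \<longleftrightarrow> even i"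
      using cells[OF x] by (elim exE conjE) (rule that)
    \<comment> \<open>Colour \<open>b\<close> consists of the even cells, of sizes \<open>1\<close>,
      \<open>2 * k\<close>, \<open>1\<close>, if \<open>b = s x\<close>, and otherwise of the odd
      cells, of sizes \<open>k\<close>, \<open>k\<close>, \<open>2\<close>.\<close>
    define I :: "nat set" where "I = {i. i < 6 \<and> even i = (b = s x)}"
    have "{y \<in> pverts G. s y = b} = (\<Union>i\<in>I. B i)"
    proof (intro equalityI subsetI)
      fix y assume "y \<in> {y \<in> pverts G. s y = b}"
      then obtain i where "i < 6" "y \<in> B i" "s y = b" using un by blast
      then show "y \<in> (\<Union>i\<in>I. B i)" using sd[of i y] by (auto simp: I_def)
    next
      fix y assume "y \<in> (\<Union>i\<in>I. B i)"
      then obtain i where "i < 6" "y \<in> B i" "even i = (b = s x)" by (auto simp: I_def)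
      then show "y \<in> {y \<in> pverts G. s y = b}" using sd[of i y] un by auto
    qed
    moreover have "card (\<Union>i\<in>I. B i) = (\<Sum>i\<in>I. card (B i))"
    proof (rule card_UN_disjoint)
      show "finite I" by (simp add: I_def)
      have "finite (B i)" if "i < 6" for i
        using un that finite_pverts[OF G] by (metis UN_upper finite_subset lessThan_iff)
      then show "\<forall>i\<in>I. finite (B i)" by (simp add: I_def)
      show "\<forall>i\<in>I. \<forall>j\<in>I. i \<noteq> j \<longrightarrow> B i \<inter> B j = {}" using dj by (auto simp: I_def)
    qed
    moreover have "\<dots> = (\<Sum>i\<in>I. Qk_size k i)" by (intro sum.cong) (auto simp: sz I_def)
    moreover have "I = (if b = s x then {0, 2, 4} else {1, 3, 5})"
      by (auto simp: I_def) presburger+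
    ultimately show "card {y \<in> pverts G. s y = b} = 2 * k + 2"
      by (simp add: Qk_size_def split: if_splits)
  next
    fix x assume x: "x \<in> pverts G"
    obtain B where un: "(\<Union>i<6. B i) = pverts G" and B0: "B 0 = {x}"
      and sz [rule_format]: "\<forall>i<6. card (B i) = Qk_size k i"
      and dj [rule_format]: "\<forall>i<6. \<forall>j<6. \<forall>y. y \<in> B i \<longrightarrow> y \<in> B j \<longrightarrow> i = j"
      and q [rule_format]: "\<forall>i<6. \<forall>j<6. \<forall>y\<in>B i. card (nbrs G y \<inter> B j) = Qk_quot k i j"
      and sd [rule_format]: "\<forall>i<6. \<forall>y\<in>B i. s y = s x \<longleftrightarrow> even i"
      using cells[OF x] by (elim exE conjE) (rule that)
    have finB: "finite (B i)" if "i < 6" for i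
      using un that finite_pverts[OF G] by (metis UN_upper finite_subset lessThan_iff)
    \<comment> \<open>If all neighbours of \<open>y\<close> lie in one cell and are as many as its
      vertices, they fill it.\<close>
    have nbrs_cell: "nbrs G y = B j"
      if "y \<in> B i" "i < 6" "j < 6" "\<And>l. l < 6 \<Longrightarrow> l \<noteq> j \<Longrightarrow> Qk_quot k i l = 0"
        "Qk_quot k i j = Qk_size k j" for y i j
    proof -
      have "nbrs G y \<subseteq> B j"
      proof
        fix z assume z: "z \<in> nbrs G y"
        then obtain l where l: "l < 6" "z \<in> B l" using un nbrs_subset[OF G] by blast
        then have "card (nbrs G y \<inter> B l) \<noteq> 0" using z finite_nbrs[OF G, of y] by auto
        then show "z \<in> B j" using q[OF that(2) l(1) that(1)] that(4)[OF l(1)] l by metis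
      qed
      moreover from this have "card (nbrs G y) = card (B j)"
        using q[OF that(2,3,1)] that(5) sz[OF that(3)] by (simp add: Int_absorb2)
      ultimately show ?thesis using finB[OF that(3)] card_subset_eq by blast
    qed
    have Nx: "nbrs G x = B 1"
    proof (rule nbrs_cell[of x 0])
      fix l :: nat assume "l < 6" "l \<noteq> 1"
      then have "l \<in> {0, 2, 3, 4, 5}" by auto
      then show "Qk_quot k 0 l = 0" by (auto simp: Qk_quot_def)
    qed (simp_all add: B0 Qk_quot_def Qk_size_def)
    then show "card (nbrs G x) = k" using sz[of 1] by (simp add: Qk_size_def)
    have "card (B 4) = 1" using sz[of 4] by (simp add: Qk_size_def)
    then obtain x' where x': "B 4 = {x'}" by (auto simp: card_1_singleton_iff)
    have Nx': "nbrs G x' = B 3"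
    proof (rule nbrs_cell[of x' 4])
      fix l :: nat assume "l < 6" "l \<noteq> 3"
      then have "l \<in> {0, 1, 2, 4, 5}" by auto
      then show "Qk_quot k 4 l = 0" by (auto simp: Qk_quot_def)
    qed (simp_all add: x' Qk_quot_def Qk_size_def)
    show "\<exists>x'\<in>pverts G. s x' = s x \<and> x' \<noteq> x \<and> nbrs G x \<inter> nbrs G x' = {} \<and>
      (\<forall>y\<in>pverts G. s y = s x \<longrightarrow> y \<noteq> x \<longrightarrow> y \<noteq> x' \<longrightarrow> card (nbrs G x \<inter> nbrs G y) = m)"
    proof (intro bexI conjI ballI impI)
      have "x' \<in> (\<Union>i<6. B i)" using x' by (intro UN_I[of 4]) auto
      then show "x' \<in> pverts G" using un by simp
      show "s x' = s x" using sd[of 4 x'] x' by simp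
      show "x' \<noteq> x" using dj[of 0 4 x] B0 x' by auto
      show "nbrs G x \<inter> nbrs G x' = {}" unfolding Nx Nx' using dj[of 1 3] by auto
    next
      fix y assume y: "y \<in> pverts G" "s y = s x" "y \<noteq> x" "y \<noteq> x'"
      then obtain i where i: "i < 6" "y \<in> B i" using un by blast
      then have "even i" using sd y by blast
      with i(1) have "i = 0 \<or> i = 2 \<or> i = 4" by presburger
      then have "y \<in> B 2" using i y B0 x' by auto
      then have "card (nbrs G y \<inter> B 1) = m" using q[of 2 1 y] k by (simp add: Qk_quot_def)
      then show "card (nbrs G x \<inter> nbrs G y) = m" by (simp add: Nx Int_commute)
    qed
  qed
  then show ?thesis by blast
qed

section \<open>From association schemes to the diagram\<close>

lemma sym_assoc_scheme_rel_0:
  assumes "sym_assoc_scheme n X R"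
  shows "R 0 = Id_on X"
proof -
  obtain xs where xs: "distinct xs" "set xs = X"
    and one: "(rel_mat xs (R 0) :: real mat) = 1\<^sub>m (card X)" and sub: "R 0 \<subseteq> X \<times> X"
    using assms unfolding sym_assoc_scheme_def by (metis le0)
  have len: "length xs = card X" using xs distinct_card by metis
  have "(x, y) \<in> R 0 \<longleftrightarrow> x = y" if xy: "x \<in> X" "y \<in> X" for x y
  proof -
    obtain a b where ab: "a < length xs" "b < length xs" "x = xs ! a" "y = xs ! b"
      using xy xs(2) by (metis in_set_conv_nth)
    have "(if (xs ! a, xs ! b) \<in> R 0 then 1 else 0 :: real) = 1\<^sub>m (card X) $$ (a, b)"
      using one index_rel_mat[OF ab(1,2), of "R 0"] by metis
    then show ?thesis
      using ab len nth_eq_iff_index_eq[OF xs(1) ab(1,2)] by (auto split: if_splits)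
  qed
  then show ?thesis using sub by auto
qed

text \<open>\<open>\<sigma>\<close> fixes 0 and \<open>R 0\<close> is the identity relation, so cell
  0 around \<open>x\<close> is \<open>{x}\<close>.\<close>

lemma relation_graph_imp_Q_regular:
  assumes "relation_graph_with_diagram G n s q"
  shows "Q_regular G (n + 1) s q"
proof -
  obtain X R i \<sigma> where sch: "sym_assoc_scheme n X R" and G: "G = \<lparr>pverts = X, parcs = R i\<rparr>"
    and perm: "\<sigma> permutes {1..n}"
    and d: "\<And>x. x \<in> X \<Longrightarrow> distribution_diagram G (n + 1) (\<lambda>j. {y \<in> X. (x, y) \<in> R (\<sigma> j)}) s q"
    using assms unfolding relation_graph_with_diagram_def by blast
  have "\<sigma> 0 = 0" using permutes_not_in[OF perm, of 0] by simp
  then have cell_0: "{y \<in> X. (x, y) \<in> R (\<sigma> 0)} = {x}" if "x \<in> X" for x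
    using sym_assoc_scheme_rel_0[OF sch] that by auto
  show ?thesis
    unfolding Q_regular_def
  proof
    fix x assume "x \<in> pverts G"
    then have "x \<in> X" using G by simp
    then show "\<exists>B. distribution_diagram G (n + 1) B s q \<and> B 0 = {x}"
      using d cell_0 by (intro exI conjI)
  qed
qed

lemma graph_connected_nonempty:
  assumes "graph_connected G"
  shows "pverts G \<noteq> {}"
  using assms unfolding graph_connected_def connected_def strongly_connected_def by simp

theorem theorem3p3:
  fixes G :: "'a pair_pre_digraph" and v k :: nat
  assumes "k \<ge> 5" and "odd k"
    and "pair_graph G"
    and "graph_connected G"
    and "amply_regular G v k 0 ((k - 1) div 2)"
    and "graph_diameter G = 4"
  shows "((bipartite G \<and> Q_regular G 6 (Qk_size k) (Qk_quot k)) \<longleftrightarrow>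
            incidence_graph_of_gdddp G 2 (k + 1) k 0 ((k - 1) div 2)) \<and>
         (incidence_graph_of_gdddp G 2 (k + 1) k 0 ((k - 1) div 2) \<longleftrightarrow>
            relation_graph_with_diagram G 5 (Qk_size k) (Qk_quot k)) \<and>
         (relation_graph_with_diagram G 5 (Qk_size k) (Qk_quot k) \<longrightarrow>
            bipartite G \<and> walk_regular 2 G \<and> card (pverts G) = 4 * k + 4 \<and>
            graph_diameter G = 4 \<and> card (graph_eigenvalues G) = 6)"
proof -
  define m where "m = (k - 1) div 2"
  have k: "k = 2 * m + 1" "m \<ge> 2"
    using assms(1,2) by (auto simp: m_def elim!: oddE)
  \<comment> \<open>\<open>?D\<close> is the hub: \<open>?Q\<close> and \<open>?I\<close> are each
    equivalent to it, it implies \<open>?R\<close>, and \<open>?R\<close> leads back through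
    \<open>?Q\<close>.\<close>
  let ?D = "\<exists>s \<tau>. divisible_bipartite G s \<tau> k m"
  let ?Q = "bipartite G \<and> Q_regular G 6 (Qk_size k) (Qk_quot k)"
  let ?I = "incidence_graph_of_gdddp G 2 (k + 1) k 0 m"
  let ?R = "relation_graph_with_diagram G 5 (Qk_size k) (Qk_quot k)"
  have "?Q \<longleftrightarrow> ?D"
    using Q_regular_imp_divisible_bipartite[OF assms(3) k graph_connected_nonempty[OF assms(4)]]
      divisible_bipartite.bipartite divisible_bipartite.Q_regular by blast
  moreover have "?I \<longleftrightarrow> ?D"
    using incidence_graph_imp_divisible_bipartite[OF assms(3) k]
      divisible_bipartite.incidence_graph by blast
  moreover have "?Q" if ?R
  proof -
    have "Q_regular G 6 (Qk_size k) (Qk_quot k)"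
      using relation_graph_imp_Q_regular[OF that] by simp
    then show ?thesis using Q_regular_imp_bipartite[OF assms(3)] by blast
  qed
  moreover have "?D \<Longrightarrow> ?R"
    using divisible_bipartite.relation_graph by blast
  moreover have "?D \<Longrightarrow> walk_regular 2 G \<and> card (pverts G) = 4 * k + 4 \<and>
      card (graph_eigenvalues G) = 6"
    using divisible_bipartite.walk_regular divisible_bipartite.order
      divisible_bipartite.card_eigenvalues assms(4) by metis
  ultimately show ?thesis unfolding m_def[symmetric] using assms(6) by blast
qed

end
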